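(* There is an algorithm which, given any $m$-edge AT-free graph $G=(V,E)$, computes the eccentricities $e_G(w)$ of all vertices $w\in V$ in ${\cal O}(m^{3/2})$ time.
   Context: All graphs are finite, simple and connected. $dist_G(u,v)$ is the number of edges of a shortest $uv$-path, and the eccentricity of $u$ is $e_G(u)=\max_{v\in V} dist_G(u,v)$. For a vertex $v$, $N[v]$ denotes its closed neighbourhood. Three vertices form an asteroidal triple (AT) if between any two of them there is a path avoiding the closed neighbourhood of the third one; a graph is AT-free if it contains no asteroidal triple. *)

theory Defs
  imports
    "Graph_Theory.Graph_Theory"
    "HOL-Library.Landau_Symbols"
begin

section \<open>Eccentricities and asteroidal triples\<close>

text \<open>
  Finite simple graphs are those of the locale \<open>pair_graph\<close>: an undirected edge between \<open>u\<close> and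
  \<open>v\<close> is represented by the two opposite arcs \<open>(u, v)\<close> and \<open>(v, u)\<close>. Hence the division by two
  in the number of edges.
\<close>

definition num_edges :: "'a pair_pre_digraph \<Rightarrow> nat" where
  "num_edges G = card (parcs G) div 2"

definition neighbours :: "'a pair_pre_digraph \<Rightarrow> 'a \<Rightarrow> 'a set" where
  "neighbours G v = {w. (v, w) \<in> parcs G}"

definition closed_neighbourhood :: "'a pair_pre_digraph \<Rightarrow> 'a \<Rightarrow> 'a set" where
  "closed_neighbourhood G v = insert v (neighbours G v)"

definition gdist :: "'a pair_pre_digraph \<Rightarrow> 'a \<Rightarrow> 'a \<Rightarrow> nat" where
  "gdist G u v = (LEAST k. \<exists>p. pre_digraph.apath (with_proj G) u p v \<and> length p = k)"

definition eccentricity :: "'a pair_pre_digraph \<Rightarrow> 'a \<Rightarrow> nat" where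
  "eccentricity G u = Max (gdist G u ` pverts G)"

definition path_avoiding :: "'a pair_pre_digraph \<Rightarrow> 'a \<Rightarrow> 'a \<Rightarrow> 'a set \<Rightarrow> bool" where
  "path_avoiding G u v S \<longleftrightarrow>
     (\<exists>p. pre_digraph.apath (with_proj G) u p v \<and>
          set (pre_digraph.awalk_verts (with_proj G) u p) \<inter> S = {})"

definition asteroidal_triple :: "'a pair_pre_digraph \<Rightarrow> 'a \<Rightarrow> 'a \<Rightarrow> 'a \<Rightarrow> bool" where
  "asteroidal_triple G x y z \<longleftrightarrow>
     {x, y, z} \<subseteq> pverts G \<and> distinct [x, y, z] \<and>
     path_avoiding G x y (closed_neighbourhood G z) \<and>
     path_avoiding G y z (closed_neighbourhood G x) \<and>
     path_avoiding G x z (closed_neighbourhood G y)"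

definition AT_free :: "'a pair_pre_digraph \<Rightarrow> bool" where
  "AT_free G \<longleftrightarrow> \<not> (\<exists>x y z. asteroidal_triple G x y z)"


section \<open>A unit-cost random access machine\<close>

text \<open>
  Programs of a random access machine, in structured form. The memory consists of registers and
  of arrays; a fixed program mentions only finitely many of either. Arithmetic is restricted to
  addition and truncated subtraction.
\<close>

datatype aexp =
    N nat
  | V string
  | Arr string aexp
  | Plus aexp aexp
  | Minus aexp aexp

datatype bexp =
    Less aexp aexp
  | Eq aexp aexp
  | Neg bexp
  | Conj bexp bexp

datatype com =
    SKIP
  | Assign string aexp
  | Store string aexp aexp
  | Seq com com
  | Cond bexp com com
  | While bexp com

record state =
  reg :: "string \<Rightarrow> nat"
  arr :: "string \<Rightarrow> nat \<Rightarrow> nat"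

primrec aval :: "aexp \<Rightarrow> state \<Rightarrow> nat" where
  "aval (N k) s = k"
| "aval (V x) s = reg s x"
| "aval (Arr a e) s = arr s a (aval e s)"
| "aval (Plus e1 e2) s = aval e1 s + aval e2 s"
| "aval (Minus e1 e2) s = aval e1 s - aval e2 s"

primrec bval :: "bexp \<Rightarrow> state \<Rightarrow> bool" where
  "bval (Less e1 e2) s \<longleftrightarrow> aval e1 s < aval e2 s"
| "bval (Eq e1 e2) s \<longleftrightarrow> aval e1 s = aval e2 s"
| "bval (Neg b) s \<longleftrightarrow> \<not> bval b s"
| "bval (Conj b1 b2) s \<longleftrightarrow> bval b1 s \<and> bval b2 s"

primrec acost :: "aexp \<Rightarrow> nat" where
  "acost (N k) = 1"
| "acost (V x) = 1"
| "acost (Arr a e) = 1 + acost e"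
| "acost (Plus e1 e2) = 1 + acost e1 + acost e2"
| "acost (Minus e1 e2) = 1 + acost e1 + acost e2"

primrec bcost :: "bexp \<Rightarrow> nat" where
  "bcost (Less e1 e2) = 1 + acost e1 + acost e2"
| "bcost (Eq e1 e2) = 1 + acost e1 + acost e2"
| "bcost (Neg b) = 1 + bcost b"
| "bcost (Conj b1 b2) = 1 + bcost b1 + bcost b2"

text \<open>
  \<open>exec B c s t s'\<close>: started in state \<open>s\<close>, the program \<open>c\<close> terminates after \<open>t\<close> steps in state
  \<open>s'\<close>, and on the way neither a stored value nor the index of a written array cell exceeds \<open>B\<close>;
  a program that violates the bound gets stuck. The bound rules out that long computations are
  packed into single operations on huge numbers. It need not be imposed on the intermediate values
  of an expression: in the absence of multiplication they exceed the values stored in memory and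
  the constants of the program by at most a factor that depends only on the expression.
\<close>

inductive exec :: "nat \<Rightarrow> com \<Rightarrow> state \<Rightarrow> nat \<Rightarrow> state \<Rightarrow> bool" for B :: nat where
  Skip: "exec B SKIP s 1 s"
| Assign: "aval e s \<le> B \<Longrightarrow>
    exec B (Assign x e) s (1 + acost e) (s\<lparr>reg := (reg s)(x := aval e s)\<rparr>)"
| Store: "aval i s \<le> B \<Longrightarrow> aval e s \<le> B \<Longrightarrow>
    exec B (Store a i e) s (1 + acost i + acost e)
      (s\<lparr>arr := (arr s)(a := (arr s a)(aval i s := aval e s))\<rparr>)"
| Seq: "exec B c1 s t1 s1 \<Longrightarrow> exec B c2 s1 t2 s2 \<Longrightarrow>
    exec B (Seq c1 c2) s (t1 + t2) s2"
| CondTrue: "bval b s \<Longrightarrow> exec B c1 s t s1 \<Longrightarrow>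
    exec B (Cond b c1 c2) s (1 + bcost b + t) s1"
| CondFalse: "\<not> bval b s \<Longrightarrow> exec B c2 s t s1 \<Longrightarrow>
    exec B (Cond b c1 c2) s (1 + bcost b + t) s1"
| WhileFalse: "\<not> bval b s \<Longrightarrow>
    exec B (While b c) s (1 + bcost b) s"
| WhileTrue: "bval b s \<Longrightarrow> exec B c s t1 s1 \<Longrightarrow> exec B (While b c) s1 t2 s2 \<Longrightarrow>
    exec B (While b c) s (1 + bcost b + t1 + t2) s2"

inductive_cases exec_elims:
  "exec B SKIP s t s'"
  "exec B (Assign x e) s t s'"
  "exec B (Store a i e) s t s'"
  "exec B (Seq c1 c2) s t s'"
  "exec B (Cond b c1 c2) s t s'"

inductive_cases exec_WhileE: "exec B (While b c) s t s'"

text \<open>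
  Programs are deterministic, so that the existence of a terminating execution says
  something about the only execution there is.
\<close>

lemma exec_deterministic:
  "exec B c s t s' \<Longrightarrow> exec B c s u s'' \<Longrightarrow> t = u \<and> s' = s''"
proof (induction arbitrary: u s'' rule: exec.induct)
  case (Seq c1 s t1 s1 c2 t2 s2)
  from Seq.prems obtain u1 r1 u2 where
    "exec B c1 s u1 r1" "exec B c2 r1 u2 s''" "u = u1 + u2"
    by (auto elim: exec_elims)
  with Seq.IH show ?case by blast
next
  case (CondTrue b s c1 t s1 c2)
  from CondTrue.prems CondTrue.hyps(1) obtain u1 where
    "exec B c1 s u1 s''" "u = 1 + bcost b + u1"
    by (auto elim: exec_elims)
  with CondTrue.IH show ?case by blast
next
  case (CondFalse b s c2 t s1 c1)
  from CondFalse.prems CondFalse.hyps(1) obtain u1 where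
    "exec B c2 s u1 s''" "u = 1 + bcost b + u1"
    by (auto elim: exec_elims)
  with CondFalse.IH show ?case by blast
next
  case (WhileTrue b s c t1 s1 t2 s2)
  from WhileTrue.prems WhileTrue.hyps(1) obtain u1 r1 u2 where
    "exec B c s u1 r1" "exec B (While b c) r1 u2 s''" "u = 1 + bcost b + u1 + u2"
    by (auto elim: exec_WhileE)
  with WhileTrue.IH show ?case by blast
next
  case (WhileFalse b s c)
  then show ?case by (auto elim: exec_WhileE)
qed (auto elim: exec_elims)


section \<open>Graphs as input\<close>

text \<open>
  \<open>L\<close> lists, in an arbitrary order, the neighbours of each of the vertices \<open>0, \<dots>, length L - 1\<close>.
\<close>

definition adjacency_lists :: "nat pair_pre_digraph \<Rightarrow> nat list list \<Rightarrow> bool" where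
  "adjacency_lists G L \<longleftrightarrow>
     pverts G = {..<length L} \<and>
     (\<forall>v<length L. distinct (L ! v) \<and> set (L ! v) = neighbours G v)"

text \<open>
  The initial memory: the register \<open>n\<close> holds the number of vertices, the array \<open>adj\<close> holds the
  concatenation of all adjacency lists, and the list of vertex \<open>v\<close> occupies the cells of \<open>adj\<close> from
  index \<open>off[v]\<close> to \<open>off[v + 1] - 1\<close>. Everything else is zero.
\<close>

definition initial_state :: "nat list list \<Rightarrow> state" where
  "initial_state L =
     \<lparr>reg = (\<lambda>x. if x = ''n'' then length L else 0),
      arr = (\<lambda>a i.
        if a = ''off'' \<and> i \<le> length L then length (concat (take i L))
        else if a = ''adj'' \<and> i < length (concat L) then concat L ! i
        else 0)\<rparr>"

end

theory Submission
  imports Defs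
begin

text \<open>
  Call a vertex low if its degree is at most the rounded-up square root \<open>\<tau>\<close> of the number of
  arcs; all but at most \<open>\<tau>\<close> vertices are low. From a low vertex \<open>b\<close> grow a connected set \<open>B\<close>
  greedily, as long as some low vertex outside of \<open>B\<close> has no neighbour in \<open>B\<close>. At the end every
  such vertex, say \<open>x\<close>, is
  complete to the boundary of \<open>B\<close>. So all of them are equally far from any vertex of \<open>B\<close>, and the
  boundary, being contained in the neighbourhood of \<open>x\<close>, has at most \<open>\<tau>\<close> vertices. In the same
  way grow \<open>B'\<close> from \<open>x\<close>, avoiding a low vertex \<open>z\<close> of \<open>B\<close>. The remaining pairs \<open>v, w\<close> of low
  vertices lie in \<open>B \<inter> B'\<close>, and there the absence of asteroidal triples gives
  \<open>dist v w \<le> max (dist x w) (dist z w)\<close>. Hence the eccentricities are determined by breadth-first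
  searches from the \<open>O(\<tau>)\<close> vertices that are not low or belong to the closed neighbourhood of
  \<open>b\<close>, \<open>x\<close> or \<open>z\<close>.
\<close>

section \<open>Distances and filtered searches in a connected symmetric relation\<close>

text \<open>Connected sets act as certificates for avoiding paths. \<open>B\<close> misses the
  closed neighbourhood of \<open>x\<close>, so any two of its vertices are joined inside
  \<open>B\<close> away from \<open>x\<close>; \<open>B'\<close> does the same for \<open>z\<close>.
  A vertex \<open>v\<close> of both sets thus comes with two of the three paths of the triple
  \<open>x\<close>, \<open>z\<close>, \<open>v\<close>, and AT-freeness forces every path between
  \<open>x\<close> and \<open>z\<close> to pass near \<open>v\<close>. Neither this argument nor the
  one about equal distances covers the boundaries of \<open>B\<close> and \<open>B'\<close>. They
  have to be sources themselves, and they are few only because they lie in the neighbourhood of a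
  low vertex. High vertices are few because the degrees add up to the number of arcs. One search
  costs \<open>O(m)\<close>, which makes the square root the balanced threshold. The greedy growth
  takes a single pass over a queue: a vertex is refused if expanding it would reach all remaining
  candidates, and as these only become fewer, a refusal never has to be reconsidered.\<close>

definition rdist :: "('a \<times> 'a) set \<Rightarrow> 'a \<Rightarrow> 'a \<Rightarrow> nat" where
  "rdist E u v = (LEAST k. (u, v) \<in> E ^^ k)"

definition cnb :: "('a \<times> 'a) set \<Rightarrow> 'a \<Rightarrow> 'a set" where
  "cnb E v = insert v (E `` {v})"

text \<open>Walks suffice, since cutting out cycles only drops vertices. Every step checks its head,
  hence the separate check of the start.\<close>

definition avoid :: "('a \<times> 'a) set \<Rightarrow> 'a set \<Rightarrow> 'a \<Rightarrow> 'a \<Rightarrow> bool" where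
  "avoid E X u v \<longleftrightarrow> u \<notin> X \<and> (u, v) \<in> {(a, b) \<in> E. b \<notin> X}\<^sup>*"

text \<open>Distinctness is built in: a vertex lies in its own closed neighbourhood, so equal
  members violate one of the three avoidances.\<close>

definition triple_free :: "'a set \<Rightarrow> ('a \<times> 'a) set \<Rightarrow> bool" where
  "triple_free S E \<longleftrightarrow> (\<forall>x\<in>S. \<forall>y\<in>S. \<forall>z\<in>S.
     \<not> (avoid E (cnb E z) x y \<and> avoid E (cnb E x) y z \<and> avoid E (cnb E y) x z))"

text \<open>\<open>B\<close> are the expanded vertices and \<open>Q\<close> the reached ones of a search from \<open>r\<close> which
  expands a vertex only if some candidate in \<open>C\<close> stays unreached.\<close>

definition search_result ::
    "('a \<times> 'a) set \<Rightarrow> 'a \<Rightarrow> 'a set \<Rightarrow> 'a set \<Rightarrow> 'a set \<Rightarrow> bool" where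
  "search_result E r C B Q \<longleftrightarrow>
     B \<subseteq> Q \<and> Q = insert r (E `` B) \<and> (\<forall>v\<in>B. (r, v) \<in> (E \<inter> B \<times> B)\<^sup>*) \<and>
     (B \<noteq> {} \<longrightarrow> C - Q \<noteq> {}) \<and> (\<forall>s\<in>Q - B. C - Q \<subseteq> E `` {s})"

lemma rdist_le: "(u, v) \<in> E ^^ k \<Longrightarrow> rdist E u v \<le> k"
  unfolding rdist_def by (rule Least_le)

lemma search_result_subset: "search_result E r C B Q \<Longrightarrow> B \<subseteq> Q"
  unfolding search_result_def by (rule conjunct1)

lemma search_result_reached: "search_result E r C B Q \<Longrightarrow> Q = insert r (E `` B)"
  by (simp only: search_result_def)

lemma search_result_boundary:
  assumes "search_result E r C B Q" "s \<in> Q - B" "y \<in> C - Q"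
  shows "(s, y) \<in> E"
proof -
  have "\<forall>s\<in>Q - B. C - Q \<subseteq> E `` {s}" using assms(1) unfolding search_result_def by (elim conjE)
  then show ?thesis using assms(2,3) by blast
qed

lemma search_result_left:
  assumes "search_result E r C B Q" "B \<noteq> {}"
  shows "C - Q \<noteq> {}"
proof -
  have "B \<noteq> {} \<longrightarrow> C - Q \<noteq> {}" using assms(1) unfolding search_result_def by (elim conjE)
  then show ?thesis using assms(2) by blast
qed

lemma avoid_extend: "avoid E X u a \<Longrightarrow> (a, b) \<in> E \<Longrightarrow> b \<notin> X \<Longrightarrow> avoid E X u b"
  unfolding avoid_def by (auto intro: rtrancl_into_rtrancl)

lemma avoid_end: "avoid E X u v \<Longrightarrow> v \<notin> X"
  unfolding avoid_def by (auto elim: rtranclE)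

locale connected_rel =
  fixes V :: "'a set" and E :: "('a \<times> 'a) set"
  assumes E_sym: "(u, v) \<in> E \<Longrightarrow> (v, u) \<in> E"
    and E_V: "(u, v) \<in> E \<Longrightarrow> u \<in> V"
    and E_conn: "u \<in> V \<Longrightarrow> v \<in> V \<Longrightarrow> (u, v) \<in> E\<^sup>*"
begin

abbreviation "d \<equiv> rdist E"
abbreviation "nb \<equiv> cnb E"

lemma E_V2: "(u, v) \<in> E \<Longrightarrow> v \<in> V"
  using E_sym E_V by blast

lemma rdist_walk: "u \<in> V \<Longrightarrow> v \<in> V \<Longrightarrow> (u, v) \<in> E ^^ d u v"
  unfolding rdist_def using E_conn[of u v] by (metis LeastI_ex rtrancl_imp_relpow)

lemma rdist_triangle:
  assumes "u \<in> V" "v \<in> V" "w \<in> V"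
  shows "d u w \<le> d u v + d v w"
  by (rule rdist_le) (use assms rdist_walk in \<open>auto simp: relpow_add\<close>)

lemma relpow_sym: "(u, v) \<in> E ^^ k \<Longrightarrow> (v, u) \<in> E ^^ k"
proof (induction k arbitrary: v)
  case (Suc k)
  then obtain y where "(u, y) \<in> E ^^ k" "(y, v) \<in> E" by auto
  then show ?case using Suc.IH E_sym relpow_Suc_I2 by metis
qed simp

lemma rdist_commute: "d u v = d v u"
  unfolding rdist_def by (metis relpow_sym)

lemma rdist_self [simp]: "d v v = 0"
  using rdist_le[of v v 0 E] by simp

lemma rdist_eq_0: "u \<in> V \<Longrightarrow> v \<in> V \<Longrightarrow> d u v = 0 \<Longrightarrow> u = v"
  using rdist_walk[of u v] by simp

lemma rdist_edge: "(u, v) \<in> E \<Longrightarrow> d u v \<le> 1"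
  using rdist_le[of u v 1 E] by simp

lemma mem_nb_iff:
  assumes "u \<in> V" "v \<in> V"
  shows "v \<in> nb u \<longleftrightarrow> d u v \<le> 1"
proof
  assume "d u v \<le> 1"
  then have "d u v = 0 \<or> d u v = 1" by linarith
  then show "v \<in> nb u"
    using rdist_walk[OF assms] by (auto simp: cnb_def)
qed (use rdist_edge in \<open>auto simp: cnb_def\<close>)

lemma nb_commute: "v \<in> nb u \<longleftrightarrow> u \<in> nb v"
  by (auto simp: cnb_def E_sym)

lemma rdist_step:
  assumes "u \<in> V" "v \<in> V" "d u v = Suc k"
  obtains y where "y \<in> V" "(y, v) \<in> E" "d u y = k"
proof -
  obtain y where y: "(u, y) \<in> E ^^ k" "(y, v) \<in> E"
    using rdist_walk[OF assms(1,2)] assms(3) by auto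
  then have "y \<in> V" using E_V by blast
  moreover have "d u v \<le> d u y + d y v"
    using rdist_triangle \<open>y \<in> V\<close> assms by blast
  then have "d u y = k"
    using rdist_le[OF y(1)] rdist_edge[OF y(2)] assms(3) by linarith
  ultimately show thesis using that y by blast
qed

text \<open>A shortest path is one of the paths that fail to avoid \<open>X\<close>. That
  \<open>p\<close> lies on such a path is expressed by equality in the triangle inequality.\<close>

lemma geodesic_hits:
  assumes "u \<in> V" "v \<in> V" "\<not> avoid E X u v"
  obtains p where "p \<in> V" "p \<in> X" "d u p + d p v = d u v"
proof -
  have "avoid E X u v" if "u \<in> V" "v \<in> V" "\<And>p. p \<in> V \<Longrightarrow> d u p + d p v = d u v \<Longrightarrow> p \<notin> X" for v
    using that
  proof (induction "d u v" arbitrary: v)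
    case 0
    then show ?case using rdist_eq_0[of u v] by (auto simp: avoid_def)
  next
    case (Suc k)
    obtain y where y: "y \<in> V" "(y, v) \<in> E" "d u y = k"
      using rdist_step[of u v k] Suc.hyps(2) Suc.prems by metis
    \<comment> \<open>What lies between \<open>u\<close> and \<open>y\<close> also lies between
      \<open>u\<close> and \<open>v\<close>.\<close>
    have "p \<notin> X" if "p \<in> V" "d u p + d p y = d u y" for p
    proof -
      have "d p v \<le> d p y + d y v" "d u v \<le> d u p + d p v"
        using rdist_triangle y that Suc.prems by blast+
      then have "d u p + d p v = d u v"
        using that y rdist_edge[OF y(2)] Suc.hyps(2) by linarith
      then show ?thesis using Suc.prems that by blast
    qed
    then have "avoid E X u y" using Suc y by blast
    then show ?case using y avoid_extend Suc.prems by force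
  qed
  then show thesis using assms that by blast
qed

text \<open>A shortest path from \<open>x\<close> to \<open>w\<close> meets \<open>nb v\<close> in
  some \<open>p\<close> other than \<open>x\<close>, and then \<open>d v p\<close> is at most 1
  while \<open>d x p\<close> is at least 1.\<close>

lemma rdist_le_if_not_avoid:
  assumes "\<not> avoid E (nb v) x w" "x \<in> V" "v \<in> V" "w \<in> V" "x \<notin> nb v"
  shows "d v w \<le> d x w"
proof -
  obtain p where p: "p \<in> V" "p \<in> nb v" "d x p + d p w = d x w"
    using geodesic_hits[OF \<open>x \<in> V\<close> \<open>w \<in> V\<close> assms(1)] .
  then have "d x p \<noteq> 0" using assms rdist_eq_0 by metis
  moreover have "d v p \<le> 1" using p mem_nb_iff assms by blast
  moreover have "d v w \<le> d v p + d p w" using rdist_triangle p assms by blast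
  ultimately show ?thesis using p by linarith
qed

section \<open>Accepted set, boundary and unreached candidates of a filtered search\<close>

lemma search_result_connected:
  assumes "search_result E r C B Q" "v \<in> B" "v' \<in> B" "X \<inter> B = {}"
  shows "avoid E X v v'"
proof -
  let ?F = "E \<inter> B \<times> B"
  have "sym (?F\<^sup>*)" by (rule sym_rtrancl) (auto simp: sym_def E_sym)
  moreover have "(r, v) \<in> ?F\<^sup>*" using assms by (simp add: search_result_def)
  ultimately have "(v, r) \<in> ?F\<^sup>*" by (rule symD)
  moreover have "(r, v') \<in> ?F\<^sup>*" using assms by (simp add: search_result_def)
  ultimately have "(v, v') \<in> ?F\<^sup>*" by (rule rtrancl_trans)
  moreover have "?F \<subseteq> {(a, b) \<in> E. b \<notin> X}" using assms(4) by auto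
  ultimately have "(v, v') \<in> {(a, b) \<in> E. b \<notin> X}\<^sup>*"
    by (rule subsetD[OF rtrancl_mono, rotated])
  moreover have "v \<notin> X" using assms(2,4) by blast
  ultimately show ?thesis by (simp add: avoid_def)
qed

lemma search_result_root:
  assumes "search_result E r C B Q" "B \<noteq> {}"
  shows "r \<in> B"
proof -
  obtain v where "v \<in> B" "(r, v) \<in> (E \<inter> B \<times> B)\<^sup>*"
    using assms unfolding search_result_def by blast
  then show ?thesis by (metis IntE SigmaD1 converse_rtranclE)
qed

lemma search_result_disjoint:
  assumes "search_result E r C B Q" "y \<notin> Q"
  shows "nb y \<inter> B = {}"
  using assms E_sym unfolding search_result_def cnb_def by auto

lemma search_result_Q_subset:
  assumes "search_result E r C B Q" "r \<in> V"
  shows "Q \<subseteq> V"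
proof -
  have "Q = insert r (E `` B)" using assms(1) by (simp add: search_result_def)
  then show ?thesis using assms(2) E_V2 by blast
qed

text \<open>The boundary \<open>Q - B\<close> separates: expanding \<open>B\<close> reaches nothing
  but \<open>Q\<close>, so a walk from \<open>B\<close> that avoids \<open>Q - B\<close> never
  leaves \<open>B\<close>.\<close>

lemma search_result_exit:
  assumes sr: "search_result E r C B Q" and "B \<noteq> {}" "r \<in> V"
    and "w \<in> B" "y \<in> V" "y \<notin> B"
  obtains s where "s \<in> Q - B" "d w s + d s y = d w y"
proof -
  have QV: "Q \<subseteq> V" using search_result_Q_subset sr assms by blast
  have BQ: "B \<subseteq> Q" using sr by (rule search_result_subset)
  have "\<not> avoid E (Q - B) w y"
  proof
    assume "avoid E (Q - B) w y"
    then have "(w, y) \<in> {(a, b) \<in> E. b \<notin> Q - B}\<^sup>*" by (simp add: avoid_def)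
    then have "y \<in> B"
    proof induction
      case (step a b)
      moreover have "Q = insert r (E `` B)" using sr by (simp add: search_result_def)
      ultimately show ?case by blast
    qed fact
    then show False using assms by blast
  qed
  moreover have "w \<in> V" using \<open>w \<in> B\<close> BQ QV by blast
  ultimately obtain s where "s \<in> Q - B" "d w s + d s y = d w y"
    using geodesic_hits[OF _ \<open>y \<in> V\<close>] by blast
  then show thesis by (rule that)
qed

text \<open>Unreached candidates are complete to the boundary of the accepted set, through which every
  path from an accepted vertex has to leave.\<close>

lemma search_result_twins_le:
  assumes sr: "search_result E r C B Q" and B: "B \<noteq> {}" and r: "r \<in> V" and C: "C \<subseteq> V"
    and w: "w \<in> B" and y: "y \<in> C - Q" and x: "x \<in> C - Q"
  shows "d w y \<le> d w x"
proof -
  have QV: "Q \<subseteq> V" using search_result_Q_subset[OF sr r] .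
  have BQ: "B \<subseteq> Q" using search_result_subset[OF sr] .
  have V: "w \<in> V" "x \<in> V" "y \<in> V" "x \<notin> B" using QV BQ C w x y by blast+
  obtain s where s: "s \<in> Q - B" "d w s + d s x = d w x"
    using search_result_exit[OF sr B r w V(2,4)] .
  then have "s \<in> V" "s \<noteq> x" using QV x by blast+
  \<comment> \<open>From the exit point \<open>s\<close> the arc to \<open>y\<close> costs 1, and
    reaching \<open>x\<close> costs at least 1 too, because \<open>s\<close> is reached and
    \<open>x\<close> is not.\<close>
  have "d s y \<le> 1" by (rule rdist_edge) (rule search_result_boundary[OF sr s(1) y])
  moreover have "d w y \<le> d w s + d s y" using rdist_triangle V \<open>s \<in> V\<close> by blast
  moreover have "d s x \<noteq> 0" using \<open>s \<in> V\<close> \<open>s \<noteq> x\<close> V rdist_eq_0 by blast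
  ultimately show ?thesis using s by linarith
qed

lemma search_result_twins:
  assumes "search_result E r C B Q" "B \<noteq> {}" "r \<in> V" "C \<subseteq> V"
    and "w \<in> B" "y \<in> C - Q" "x \<in> C - Q"
  shows "d w y = d w x"
  using search_result_twins_le assms by (meson order_antisym)

text \<open>Any boundary vertex is a common neighbour, and there is one because a shortest path from
  the root to \<open>x\<close> has to leave \<open>B\<close>.\<close>

lemma search_result_twins_close:
  assumes sr: "search_result E r C B Q" and B: "B \<noteq> {}" and r: "r \<in> V" and C: "C \<subseteq> V"
    and y: "y \<in> C - Q" and x: "x \<in> C - Q"
  shows "d x y \<le> 2"
proof -
  have "x \<in> V" "x \<notin> B" using C x search_result_subset[OF sr] by blast+
  then obtain s where s: "s \<in> Q - B"
    using search_result_exit[OF sr B r search_result_root[OF sr B]] by blast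
  have "(s, y) \<in> E" "(s, x) \<in> E"
    using search_result_boundary[OF sr s y] search_result_boundary[OF sr s x] .
  then have "(x, y) \<in> E ^^ 2" using E_sym by (auto simp: numeral_2_eq_2)
  then show ?thesis by (rule rdist_le)
qed

section \<open>Distance bounds from the absence of asteroidal triples\<close>

lemma rdist_middle:
  assumes AT: "triple_free V E"
    and V: "x \<in> V" "z \<in> V" "v \<in> V"
    and av: "avoid E (nb x) v z" "avoid E (nb z) x v"
    and not: "v \<notin> nb x"
  shows "\<not> avoid E (nb v) x z" and "d x v \<le> d x z"
proof -
  \<comment> \<open>Two of the three paths of the triple \<open>x\<close>, \<open>v\<close>,
    \<open>z\<close> are given, so the third cannot exist.\<close>
  show *: "\<not> avoid E (nb v) x z"
    using AT V av unfolding triple_free_def by blast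
  obtain p where p: "p \<in> V" "p \<in> nb v" "d x p + d p z = d x z"
    using geodesic_hits[OF \<open>x \<in> V\<close> \<open>z \<in> V\<close> *] .
  \<comment> \<open>As \<open>z\<close> is not in \<open>nb v\<close>, the path continues after
    \<open>p\<close>, and its next arc pays for the one from \<open>p\<close> to
    \<open>v\<close>.\<close>
  have "p \<noteq> z" using avoid_end[OF av(2)] p(2) nb_commute by blast
  then have "d p z \<noteq> 0" using p V rdist_eq_0 by metis
  moreover have "d p v \<le> 1" using p V mem_nb_iff nb_commute by metis
  moreover have "d x v \<le> d x p + d p v" using rdist_triangle p V by blast
  ultimately show "d x v \<le> d x z" using p by linarith
qed

lemma two_step_hits:
  assumes "\<not> avoid E X x z" "(x, y) \<in> E" "(y, w) \<in> E" "(w, y') \<in> E" "(y', z) \<in> E"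
  shows "{x, y, w, y', z} \<inter> X \<noteq> {}"
proof (rule ccontr)
  assume a: "\<not> ?thesis"
  then have "avoid E X x x" by (simp add: avoid_def)
  then have "avoid E X x y" using assms a avoid_extend[of E X x x y] by simp
  then have "avoid E X x w" using assms a avoid_extend[of E X x y w] by simp
  then have "avoid E X x y'" using assms a avoid_extend[of E X x w y'] by simp
  then have "avoid E X x z" using assms a avoid_extend[of E X x y' z] by simp
  then show False using assms by blast
qed

lemma rdist_two:
  assumes "x \<in> V" "w \<in> V" "d x w = 2"
  obtains y where "(x, y) \<in> E" "(y, w) \<in> E"
  using rdist_walk[OF assms(1,2)] assms(3) that by (auto simp: numeral_2_eq_2)

text \<open>If the ends \<open>x\<close> and \<open>z\<close> lie beyond \<open>w\<close> as seen from \<open>v\<close>, every shortest path between \<open>x\<close>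
  and \<open>z\<close> passes by \<open>v\<close> and, before and after that, by \<open>w\<close>; so \<open>v\<close> and \<open>w\<close> are close.\<close>

lemma rdist_middle_pair:
  assumes AT: "triple_free V E"
    and V: "x \<in> V" "z \<in> V" "v \<in> V" "w \<in> V"
    and avx: "avoid E (nb x) v z" "avoid E (nb x) v w"
    and avz: "avoid E (nb z) x v" "avoid E (nb z) v w"
    and notx: "v \<notin> nb x" "w \<notin> nb x" and notz: "v \<notin> nb z" "w \<notin> nb z"
  shows "d v w \<le> d x w \<or> d v w \<le> d z w"
proof (rule ccontr)
  assume "\<not> ?thesis"
  then have less: "d x w < d v w" "d z w < d v w" by auto
  have far: "2 \<le> d x w" "2 \<le> d z w"
    using notx notz V mem_nb_iff by (metis Suc_1 not_less_eq_eq One_nat_def)+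
  have avxw: "\<not> avoid E (nb v) x z"
    using rdist_middle(1)[OF AT V(1-3) avx(1) avz(1) notx(1)] .
  \<comment> \<open>If every path from \<open>x\<close> to \<open>w\<close> came near
    \<open>v\<close>, then \<open>v\<close> would be no farther from \<open>w\<close> than
    \<open>x\<close> is.\<close>
  have a1: "avoid E (nb v) x w"
    using rdist_le_if_not_avoid[of v x w] V less notx nb_commute by (metis not_less)
  have a2: "avoid E (nb v) z w"
    using rdist_le_if_not_avoid[of v z w] V less notz nb_commute by (metis not_less)
  \<comment> \<open>The triple \<open>x\<close>, \<open>v\<close>, \<open>w\<close> now has two of
    its paths, so every path from \<open>x\<close> to \<open>v\<close> comes near \<open>w\<close>;
    likewise from \<open>z\<close>.\<close>
  have b1: "\<not> avoid E (nb w) x v"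
    using AT V avx(2) a1 unfolding triple_free_def by blast
  have b2: "\<not> avoid E (nb w) z v"
    using AT V avz(2) a2 unfolding triple_free_def by blast
  have wv: "w \<notin> nb v"
    using mem_nb_iff[of v w] V far less by linarith
  obtain q where q: "q \<in> V" "q \<in> nb v" "d x q + d q z = d x z"
    using geodesic_hits[OF \<open>x \<in> V\<close> \<open>z \<in> V\<close> avxw] .
  have hit: "\<exists>a\<in>V. a \<in> nb w \<and> d y a + d a q = d y q" if "y \<in> V" "\<not> avoid E (nb w) y v" for y
  proof -
    have "\<not> avoid E (nb w) y q"
    proof
      \<comment> \<open>Such a walk would extend to \<open>v\<close>, since \<open>q\<close> is
        \<open>v\<close> or a neighbour of it and \<open>v\<close> is not near
        \<open>w\<close>.\<close>
      assume "avoid E (nb w) y q"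
      then have "avoid E (nb w) y v" if "q \<noteq> v"
        using avoid_extend[of E "nb w" y q v] q that wv nb_commute E_sym by (auto simp: cnb_def)
      then show False using \<open>avoid E (nb w) y q\<close> that by blast
    qed
    then show ?thesis using geodesic_hits[of y q "nb w"] that q by metis
  qed
  obtain a where a: "a \<in> V" "a \<in> nb w" "d x a + d a q = d x q" using hit V b1 by blast
  obtain c where c: "c \<in> V" "c \<in> nb w" "d z c + d c q = d z q" using hit V b2 by blast
  have near: "d w a \<le> 1" "d w c \<le> 1" "d v q \<le> 1"
    using a c q V mem_nb_iff by blast+
  have "d x z \<le> d x a + d a z" "d a z \<le> d a c + d c z" "d a c \<le> d a w + d w c"
    using rdist_triangle V a c by blast+
  \<comment> \<open>The vertices \<open>a\<close>, \<open>q\<close>, \<open>c\<close> occur in this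
    order on a shortest path, and \<open>a\<close> and \<open>c\<close> are at most 2 apart because
    both are near \<open>w\<close>. So one of them is within 1 of \<open>q\<close>, which bounds
    \<open>d v w\<close> by 3.\<close>
  then have "d a q + d c q \<le> 2"
    using near q(3) a(3) c(3) rdist_commute[of z c] rdist_commute[of z q] rdist_commute[of a w]
    by linarith
  moreover have "d v w \<le> d v q + d q w" "d q w \<le> d q a + d a w" "d q w \<le> d q c + d c w"
    using rdist_triangle V a c q by blast+
  ultimately have "d v w \<le> 3"
    using near rdist_commute[of a w] rdist_commute[of c w] rdist_commute[of q a] rdist_commute[of q c]
    by linarith
  \<comment> \<open>The strict inequalities leave only this configuration.\<close>
  then have two: "d x w = 2" "d w z = 2" "d v w = 3"
    using less far rdist_commute[of w z] by linarith+
  obtain y where y: "(x, y) \<in> E" "(y, w) \<in> E" using rdist_two two V by metis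
  obtain y' where y': "(w, y') \<in> E" "(y', z) \<in> E" using rdist_two two V by metis
  \<comment> \<open>The walk through \<open>w\<close> also has to come near \<open>v\<close>. Its
    ends and \<open>w\<close> do not, so \<open>y\<close> or \<open>y'\<close> does, and then
    \<open>v\<close> is within 2 of \<open>w\<close>.\<close>
  have "{x, y, w, y', z} \<inter> nb v \<noteq> {}" using two_step_hits[OF avxw y y'] .
  then have "y \<in> nb v \<or> y' \<in> nb v" using wv notx notz nb_commute by auto
  then obtain t where "t \<in> nb v" "(t, w) \<in> E" using y y' E_sym by blast
  then have "d v t \<le> 1" "d t w \<le> 1" "t \<in> V" using mem_nb_iff V E_V rdist_edge by blast+
  then show False using rdist_triangle[of v t w] V two by linarith
qed

text \<open>The conditions on \<open>x\<close> and \<open>z\<close> are conditional because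
  \<open>pick\<close> keeps the previous root if no candidate is left unreached. A vertex
  \<open>w\<close> outside \<open>R\<close> shows that both searches expand something, and so both
  choices are genuine. The farthest source is then \<open>x\<close> or \<open>z\<close> or, for
  pairs at distance at most 2, any source whose closed neighbourhood misses
  \<open>w\<close>.\<close>

theorem centre_cover:
  assumes AT: "triple_free V E"
    and C: "C \<subseteq> V" and b: "b \<in> C"
    and sr: "search_result E b C B Q"
    and sr': "search_result E x (C \<inter> B) B' Q'"
    and x: "C - Q \<noteq> {} \<Longrightarrow> x \<in> C - Q"
    and z: "C \<inter> B - Q' \<noteq> {} \<Longrightarrow> z \<in> C \<inter> B - Q'"
    and R: "V - C \<subseteq> R" "nb b \<subseteq> R" "nb x \<subseteq> R" "nb z \<subseteq> R"
    and w: "w \<in> V" "w \<notin> R" and v: "v \<in> V"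
  shows "\<exists>r\<in>R. d w v \<le> d w r"
proof (cases "v \<in> R")
  case True
  then show ?thesis by blast
next
  case False
  have wC: "w \<in> C" and vC: "v \<in> C" using w v False R by auto
  have mem: "b \<in> R" "x \<in> R" "z \<in> R" using R by (auto simp: cnb_def)
  have bV: "b \<in> V" using C b by blast
  \<comment> \<open>If the root itself is rejected, all other candidates are adjacent to
    \<open>b\<close>, and \<open>w\<close> would be in \<open>R\<close>.\<close>
  have "B \<noteq> {}"
  proof
    assume "B = {}"
    then have "Q = {b}" using search_result_reached[OF sr] by simp
    then have "C - {b} \<subseteq> E `` {b}" using search_result_boundary[OF sr] \<open>B = {}\<close> by blast
    then show False using wC w R by (auto simp: cnb_def)
  qed
  then have xC: "x \<in> C - Q" and bB: "b \<in> B"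
    using x search_result_left[OF sr] search_result_root[OF sr] by blast+
  have BQ: "B \<subseteq> Q" using sr by (rule search_result_subset)
  have xV: "x \<in> V" using xC C by blast
  have NxB: "nb x \<inter> B = {}" using search_result_disjoint[OF sr] xC by blast
  \<comment> \<open>The candidate \<open>b\<close> lies in \<open>B\<close>, hence outside
    \<open>nb x\<close>, so the root \<open>x\<close> is not rejected.\<close>
  have "B' \<noteq> {}"
  proof
    assume "B' = {}"
    then have "Q' = {x}" using search_result_reached[OF sr'] by simp
    then have "C \<inter> B - {x} \<subseteq> E `` {x}" using search_result_boundary[OF sr'] \<open>B' = {}\<close> by blast
    then show False using bB b NxB by (auto simp: cnb_def)
  qed
  then have zC: "z \<in> C \<inter> B - Q'" and xB': "x \<in> B'"
    using z search_result_left[OF sr'] search_result_root[OF sr'] by blast+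
  have zV: "z \<in> V" using zC C by blast
  have NzB': "nb z \<inter> B' = {}" using search_result_disjoint[OF sr'] zC by blast
  have QN: "Q - B \<subseteq> nb x" "Q' - B' \<subseteq> nb z"
    using search_result_boundary[OF sr _ xC] search_result_boundary[OF sr' _ zC] E_sym
    by (auto simp: cnb_def)
  \<comment> \<open>Both boundaries are contained in \<open>R\<close>; outside of \<open>R\<close> a
    candidate is either accepted or unreached.\<close>
  have split: "y \<in> B \<or> y \<in> C - Q" "y \<in> B' \<or> y \<notin> Q'" if "y \<in> C" "y \<notin> R" for y
    using that QN R by blast+
  have Nw: "w \<notin> nb b" "w \<notin> nb x" "w \<notin> nb z" and Nv: "v \<notin> nb b" "v \<notin> nb x" "v \<notin> nb z"
    using R w False by blast+
  have far: "2 \<le> d w y" if "w \<notin> nb y" "y \<in> V" for y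
    using mem_nb_iff[of y w] rdist_commute[of w y] w that by simp
  have twin: "d u y = d u x" if "u \<in> B" "y \<in> C - Q" for u y
    using search_result_twins[OF sr \<open>B \<noteq> {}\<close> bV C] that xC by blast
  have twin': "d u y = d u z" if "u \<in> B'" "y \<in> C \<inter> B - Q'" for u y
    using search_result_twins[OF sr' \<open>B' \<noteq> {}\<close> xV] that zC C by blast
  have av: "avoid E (nb x) u u'" if "u \<in> B" "u' \<in> B" for u u'
    using search_result_connected[OF sr that] NxB by blast
  have av': "avoid E (nb z) u u'" if "u \<in> B'" "u' \<in> B'" for u u'
    using search_result_connected[OF sr' that] NzB' by blast
  have middle: "d x u \<le> d x z \<and> d z u \<le> d z x"
    if u: "u \<in> B" "u \<in> B'" "u \<in> V" "u \<notin> nb x" "u \<notin> nb z" for u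
  proof -
    have zB: "z \<in> B" using zC by blast
    show ?thesis
      using rdist_middle(2)[OF AT xV zV u(3) av[OF u(1) zB] av'[OF xB' u(2)] u(4)]
        rdist_middle(2)[OF AT zV xV u(3) av'[OF u(2) xB'] av[OF zB u(1)] u(5)] by blast
  qed
  show ?thesis
  proof (cases "v \<in> B")
    case vB: True
    show ?thesis
    proof (cases "w \<in> B")
      case wB: True
      consider "v \<in> B'" "w \<in> B'" | "v \<in> B'" "w \<notin> B'" | "v \<notin> B'" "w \<in> B'" | "v \<notin> B'" "w \<notin> B'"
        by blast
      then show ?thesis
      proof cases
        case 1
        then have "d v w \<le> d x w \<or> d v w \<le> d z w"
          using rdist_middle_pair[OF AT xV zV \<open>v \<in> V\<close> \<open>w \<in> V\<close>] av av' Nv Nw vB wB zC xB' by blast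
        then show ?thesis using mem rdist_commute by metis
      next
        case 2
        \<comment> \<open>Seen from \<open>B'\<close>, the vertex \<open>w\<close> is a twin of
          \<open>z\<close>; so \<open>d w v\<close> and \<open>d w x\<close> may be read as
          \<open>d z v\<close> and \<open>d z x\<close>.\<close>
        then have "w \<in> C \<inter> B - Q'" using split wC w wB by blast
        then have "d w v = d z v" using twin'[of v w] 2 rdist_commute by metis
        moreover have "d z x = d w x" using twin'[of x w] xB' \<open>w \<in> C \<inter> B - Q'\<close> rdist_commute by metis
        ultimately show ?thesis using middle[of v] vB 2 v Nv mem by metis
      next
        case 3
        then have "v \<in> C \<inter> B - Q'" using split vC False vB by blast
        then show ?thesis using twin' 3 mem by (metis order_refl)
      next
        case 4
        then have "w \<in> C \<inter> B - Q'" "v \<in> C \<inter> B - Q'" using split wC vC w wB vB False by blast+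
        then have "d w v \<le> 2"
          using search_result_twins_close[OF sr' \<open>B' \<noteq> {}\<close> xV] C by blast
        \<comment> \<open>Unreached candidates are within 2 of each other, and \<open>x\<close> is
          no closer to \<open>w\<close> than that.\<close>
        then show ?thesis using far[of x] Nw xV mem by (meson order_trans)
      qed
    next
      case wB: False
      then have "w \<in> C - Q" using split wC w by blast
      then have eq: "d w u = d x u" if "u \<in> B" for u using twin[OF that] rdist_commute by metis
      \<comment> \<open>Seen from \<open>B\<close>, the vertex \<open>w\<close> is a twin of
        \<open>x\<close>, and \<open>z\<close> belongs to \<open>B\<close>.\<close>
      have "d x v \<le> d x z"
      proof (cases "v \<in> B'")
        case True
        then show ?thesis using middle vB v Nv by blast
      next
        case False
        then have "v \<in> C \<inter> B - Q'" using split vC \<open>v \<notin> R\<close> vB by blast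
        then show ?thesis using twin' xB' by (metis order_refl)
      qed
      then show ?thesis using eq vB zC mem by (metis DiffD1 IntE)
    qed
  next
    case vB: False
    then have vM: "v \<in> C - Q" using split vC False by blast
    show ?thesis
    proof (cases "w \<in> B")
      case True
      then show ?thesis using twin[OF True vM] mem by (metis order_refl)
    next
      case False
      then have "w \<in> C - Q" using split wC w by blast
      then have "d w v \<le> 2"
        using search_result_twins_close[OF sr \<open>B \<noteq> {}\<close> bV C vM] by blast
      then show ?thesis using far[of b] Nw bV mem by (meson order_trans)
    qed
  qed
qed

end

section \<open>Walks in graphs\<close>

text \<open>\<open>gdist\<close> minimises over simple paths and \<open>rdist\<close> over all
  walks; they agree because removing cycles never lengthens a walk.\<close>

lemma (in wf_digraph) length_awalk_to_apath_le:
  assumes "awalk u p v"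
  shows "length (awalk_to_apath p) \<le> length p"
  using assms
proof (induct rule: awalk_to_apath_induct)
  case (path p)
  then have "awalk_to_apath p = p" by (auto simp: awalk_to_apath.simps)
  then show ?case by simp
next
  case (decomp p q r s)
  then have "length (q @ s) \<le> length p" by (auto elim!: awalk_cyc_decompE)
  with decomp step_awalk_to_apath[of _ p _ q r s] show ?case by simp
qed

context pair_wf_digraph
begin

lemma awalk_if_relpow:
  "(u, v) \<in> parcs G ^^ k \<Longrightarrow> u \<in> pverts G \<Longrightarrow> \<exists>p. awalk u p v \<and> length p = k"
proof (induction k arbitrary: u)
  case 0
  then show ?case by (auto simp: awalk_Nil_iff)
next
  case (Suc k)
  then obtain y where y: "(u, y) \<in> parcs G" "(y, v) \<in> parcs G ^^ k"
    by (meson relpow_Suc_E2)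
  then obtain p where "awalk y p v" "length p = k" using Suc.IH in_arcsD2 by blast
  then have "awalk u ((u, y) # p) v \<and> length ((u, y) # p) = Suc k"
    using y by (simp add: awalk_Cons_iff)
  then show ?case by blast
qed

lemma relpow_if_awalk: "awalk u p v \<Longrightarrow> (u, v) \<in> parcs G ^^ length p"
proof (induction p arbitrary: u)
  case (Cons e p)
  then have "(u, snd e) \<in> parcs G" "(snd e, v) \<in> parcs G ^^ length p"
    by (cases e; auto simp: awalk_Cons_iff)+
  then show ?case unfolding list.size(4) by (simp only: add_Suc_right add_0_right relpow_Suc_I2)
qed (auto simp: awalk_Nil_iff)

lemma awalk_if_avoid:
  assumes "avoid (parcs G) X u v" "u \<in> pverts G"
  shows "\<exists>p. awalk u p v \<and> set (pawalk_verts u p) \<inter> X = {}"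
proof -
  have "(u, v) \<in> {(a, b) \<in> parcs G. b \<notin> X}\<^sup>*" "u \<notin> X" "u \<in> pverts G"
    using assms by (auto simp: avoid_def)
  then show ?thesis
  proof (induction rule: converse_rtrancl_induct)
    case base
    then have "awalk v [] v \<and> set (pawalk_verts v []) \<inter> X = {}" by (simp add: awalk_Nil_iff)
    then show ?case by blast
  next
    case (step a b)
    then obtain p where "awalk b p v" "set (pawalk_verts b p) \<inter> X = {}"
      using in_arcsD2 by blast
    then have "awalk a ((a, b) # p) v \<and> set (pawalk_verts a ((a, b) # p)) \<inter> X = {}"
      using step by (simp add: awalk_Cons_iff)
    then show ?case by blast
  qed
qed

lemma path_avoiding_if_avoid:
  assumes "avoid (parcs G) X u v" "u \<in> pverts G"
  shows "path_avoiding G u v X"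
proof -
  obtain p where p: "awalk u p v" "set (pawalk_verts u p) \<inter> X = {}"
    using awalk_if_avoid assms by blast
  have ap: "apath u (awalk_to_apath p) v" using apath_awalk_to_apath p by blast
  then have "awalk u (awalk_to_apath p) v" by (rule awalkI_apath)
  then have "set (pawalk_verts u (awalk_to_apath p)) \<subseteq> set (pawalk_verts u p)"
    unfolding set_awalk_verts[OF \<open>awalk u (awalk_to_apath p) v\<close>] set_awalk_verts[OF p(1)]
    using awalk_to_apath_subset[OF p(1)] by (auto simp del: awalk_to_apath.simps)
  then have "set (pawalk_verts u (awalk_to_apath p)) \<inter> X = {}" using p(2) by blast
  then show ?thesis using ap unfolding path_avoiding_def awalk_verts_with_proj_eq by blast
qed

lemma gdist_eq_rdist:
  assumes "u \<in> pverts G" "v \<in> pverts G" "(u, v) \<in> (parcs G)\<^sup>*"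
  shows "gdist G u v = rdist (parcs G) u v"
proof -
  let ?k = "rdist (parcs G) u v"
  have "(u, v) \<in> parcs G ^^ ?k"
    unfolding rdist_def using assms(3) by (metis LeastI_ex rtrancl_imp_relpow)
  then obtain p where p: "awalk u p v" "length p = ?k" using awalk_if_relpow assms by blast
  have le: "?k \<le> length q" if "apath u q v" for q
    using relpow_if_awalk[OF awalkI_apath[OF that]] by (rule rdist_le)
  have ap: "apath u (awalk_to_apath p) v" using apath_awalk_to_apath p by blast
  have "length (awalk_to_apath p) = ?k"
    using le[OF ap] length_awalk_to_apath_le[OF p(1)] p(2) by simp
  then show ?thesis
    unfolding gdist_def using ap le by (intro Least_equality) auto
qed

end

context pair_graph
begin

lemma connected_rel_if_connected:
  assumes "Digraph_Component.connected (with_proj G)"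
  shows "connected_rel (pverts G) (parcs G)"
proof
  show "(v, u) \<in> parcs G" if "(u, v) \<in> parcs G" for u v
    using that pair_sym_arcs by (auto simp: symmetric_def sym_def)
  show "u \<in> pverts G" if "(u, v) \<in> parcs G" for u v
    using that by (rule in_arcsD1)
  show "(u, v) \<in> (parcs G)\<^sup>*" if "u \<in> pverts G" "v \<in> pverts G" for u v
  proof -
    have "reachable (with_proj G) u v"
      using assms that reachable_mk_symmetric_eq[of u v] pair_sym_arcs
      unfolding Digraph_Component.connected_def strongly_connected_def by simp
    then show ?thesis
      unfolding reachable_def by (auto intro: rtrancl_on_rtranclI)
  qed
qed

lemma triple_free_if_AT_free:
  assumes "AT_free G"
  shows "triple_free (pverts G) (parcs G)"
proof -
  have cn: "closed_neighbourhood G v = cnb (parcs G) v" for v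
    by (auto simp: closed_neighbourhood_def neighbours_def cnb_def)
  have mem: "v \<in> cnb (parcs G) v" for v by (simp add: cnb_def)
  show ?thesis
    unfolding triple_free_def
  proof (intro ballI notI, elim conjE)
    fix x y z
    assume V: "x \<in> pverts G" "y \<in> pverts G" "z \<in> pverts G"
      and av: "avoid (parcs G) (cnb (parcs G) z) x y" "avoid (parcs G) (cnb (parcs G) x) y z"
        "avoid (parcs G) (cnb (parcs G) y) x z"
    \<comment> \<open>Every vertex lies in its own closed neighbourhood, so neither end of an
      avoiding walk can be the avoided vertex.\<close>
    have "distinct [x, y, z]"
      using avoid_end[OF av(1)] avoid_end[OF av(2)] av(2) mem unfolding avoid_def
      by (metis distinct_length_2_or_more distinct_singleton)
    then have "asteroidal_triple G x y z"
      using V av unfolding asteroidal_triple_def cn by (simp add: path_avoiding_if_avoid)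
    then show False using assms by (auto simp: AT_free_def)
  qed
qed

end

section \<open>Total correctness with running time\<close>

text \<open>The postcondition also sees the running time, so that cost and correctness are proved
  together. One terminating run suffices because execution is deterministic.\<close>

definition wpt :: "nat \<Rightarrow> com \<Rightarrow> (nat \<Rightarrow> state \<Rightarrow> bool) \<Rightarrow> state \<Rightarrow> bool" where
  "wpt B c Q s \<longleftrightarrow> (\<exists>t s'. exec B c s t s' \<and> Q t s')"

lemma wpt_mono: "wpt B c Q s \<Longrightarrow> (\<And>t s'. Q t s' \<Longrightarrow> Q' t s') \<Longrightarrow> wpt B c Q' s"
  unfolding wpt_def by blast

lemma exec_SKIP_iff: "exec B SKIP s t s' \<longleftrightarrow> t = 1 \<and> s' = s"
  using exec.Skip[of B s] by (auto elim: exec_elims)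

lemma exec_Assign_iff:
  "exec B (Assign x e) s t s' \<longleftrightarrow>
     aval e s \<le> B \<and> t = 1 + acost e \<and> s' = s\<lparr>reg := (reg s)(x := aval e s)\<rparr>"
  using exec.Assign[of e s B x] by (auto elim: exec_elims)

lemma exec_Store_iff:
  "exec B (Store a i e) s t s' \<longleftrightarrow>
     aval i s \<le> B \<and> aval e s \<le> B \<and> t = 1 + acost i + acost e \<and>
     s' = s\<lparr>arr := (arr s)(a := (arr s a)(aval i s := aval e s))\<rparr>"
  using exec.Store[of i s B e a] by (auto elim: exec_elims)

lemma exec_Seq_iff:
  "exec B (Seq c1 c2) s t s' \<longleftrightarrow>
     (\<exists>t1 t2 s1. exec B c1 s t1 s1 \<and> exec B c2 s1 t2 s' \<and> t = t1 + t2)"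
  by (blast intro: exec.Seq elim: exec_elims)

lemma exec_Cond_iff:
  "exec B (Cond b c1 c2) s t s' \<longleftrightarrow>
     (\<exists>t1. exec B (if bval b s then c1 else c2) s t1 s' \<and> t = 1 + bcost b + t1)"
  using exec.CondTrue[of b s B c1 _ _ c2] exec.CondFalse[of b s B c2 _ _ c1]
  by (auto elim!: exec_elims)

lemma wpt_SKIP [simp]: "wpt B SKIP Q s \<longleftrightarrow> Q 1 s"
  by (simp add: wpt_def exec_SKIP_iff)

lemma wpt_Assign [simp]:
  "wpt B (Assign x e) Q s \<longleftrightarrow>
     aval e s \<le> B \<and> Q (1 + acost e) (s\<lparr>reg := (reg s)(x := aval e s)\<rparr>)"
  by (simp add: wpt_def exec_Assign_iff)

lemma wpt_Store [simp]:
  "wpt B (Store a i e) Q s \<longleftrightarrow>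
     aval i s \<le> B \<and> aval e s \<le> B \<and>
     Q (1 + acost i + acost e) (s\<lparr>arr := (arr s)(a := (arr s a)(aval i s := aval e s))\<rparr>)"
  by (simp add: wpt_def exec_Store_iff)

lemma wpt_Seq [simp]:
  "wpt B (Seq c1 c2) Q s \<longleftrightarrow> wpt B c1 (\<lambda>t1. wpt B c2 (\<lambda>t2. Q (t1 + t2))) s"
  unfolding wpt_def exec_Seq_iff by blast

lemma wpt_Cond [simp]:
  "wpt B (Cond b c1 c2) Q s \<longleftrightarrow>
     wpt B (if bval b s then c1 else c2) (\<lambda>t. Q (1 + bcost b + t)) s"
  unfolding wpt_def exec_Cond_iff by blast

text \<open>The potential pays for the running time in advance; as every iteration costs at least one
  unit, it also shows termination.\<close>

lemma wpt_While:
  assumes "I s"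
    and step: "\<And>s. I s \<Longrightarrow> bval b s \<Longrightarrow> wpt B c (\<lambda>t s'. I s' \<and> 1 + bcost b + t + \<Phi> s' \<le> \<Phi> s) s"
    and post: "\<And>t s'. I s' \<Longrightarrow> \<not> bval b s' \<Longrightarrow> t + \<Phi> s' \<le> \<Phi> s + 1 + bcost b \<Longrightarrow> Q t s'"
  shows "wpt B (While b c) Q s"
proof -
  have "\<exists>t s'. exec B (While b c) s t s' \<and> I s' \<and> \<not> bval b s' \<and> t + \<Phi> s' \<le> \<Phi> s + 1 + bcost b"
    using \<open>I s\<close>
  proof (induction "\<Phi> s" arbitrary: s rule: less_induct)
    case less
    show ?case
    proof (cases "bval b s")
      case False
      then show ?thesis
        using less.prems exec.WhileFalse[OF False] by (intro exI[of _ "1 + bcost b"] exI[of _ s]) simp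
    next
      case True
      obtain t1 s1 where 1: "exec B c s t1 s1" "I s1" "1 + bcost b + t1 + \<Phi> s1 \<le> \<Phi> s"
        using step[OF less.prems True] unfolding wpt_def by blast
      then obtain t2 s2 where 2: "exec B (While b c) s1 t2 s2" "I s2" "\<not> bval b s2"
        "t2 + \<Phi> s2 \<le> \<Phi> s1 + 1 + bcost b"
        using less.hyps[of s1] by auto
      have "exec B (While b c) s (1 + bcost b + t1 + t2) s2"
        using True 1 2 by (blast intro: exec.WhileTrue)
      moreover have "1 + bcost b + t1 + t2 + \<Phi> s2 \<le> \<Phi> s + 1 + bcost b"
        using 1 2 by linarith
      ultimately show ?thesis using 2 by blast
    qed
  qed
  then show ?thesis unfolding wpt_def using post by blast
qed

primrec wregs :: "com \<Rightarrow> string set" where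
  "wregs SKIP = {}"
| "wregs (Assign x e) = {x}"
| "wregs (Store a i e) = {}"
| "wregs (Seq c1 c2) = wregs c1 \<union> wregs c2"
| "wregs (Cond b c1 c2) = wregs c1 \<union> wregs c2"
| "wregs (While b c) = wregs c"

primrec warrs :: "com \<Rightarrow> string set" where
  "warrs SKIP = {}"
| "warrs (Assign x e) = {}"
| "warrs (Store a i e) = {a}"
| "warrs (Seq c1 c2) = warrs c1 \<union> warrs c2"
| "warrs (Cond b c1 c2) = warrs c1 \<union> warrs c2"
| "warrs (While b c) = warrs c"

text \<open>A syntactic bound on what a program can change. Loop invariants then need to mention
  only what the loop is about.\<close>

definition frame :: "com \<Rightarrow> state \<Rightarrow> state \<Rightarrow> bool" where
  "frame c s s' \<longleftrightarrow> (\<forall>x. x \<notin> wregs c \<longrightarrow> reg s' x = reg s x) \<and> (\<forall>a. a \<notin> warrs c \<longrightarrow> arr s' a = arr s a)"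

lemma exec_frame: "exec B c s t s' \<Longrightarrow> frame c s s'"
  by (induction rule: exec.induct) (auto simp: frame_def)

lemma frame_reg: "frame c s s' \<Longrightarrow> x \<notin> wregs c \<Longrightarrow> reg s' x = reg s x"
  by (simp add: frame_def)

lemma frame_refl [simp]: "frame c s s"
  by (simp add: frame_def)

lemma frame_trans: "frame c s s' \<Longrightarrow> frame c s' s'' \<Longrightarrow> frame c s s''"
  by (simp add: frame_def)

lemma wpt_frame:
  assumes "wpt B c Q s" "\<And>t s'. Q t s' \<Longrightarrow> frame c s s' \<Longrightarrow> Q' t s'"
  shows "wpt B c Q' s"
  using assms exec_frame unfolding wpt_def by blast

definition For :: "string \<Rightarrow> aexp \<Rightarrow> com \<Rightarrow> com" where
  "For i hi c = While (Less (V i) hi) (Seq c (Assign i (Plus (V i) (N 1))))"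

lemma wregs_For [simp]: "wregs (For i hi c) = insert i (wregs c)"
  and warrs_For [simp]: "warrs (For i hi c) = warrs c"
  by (auto simp: For_def)

text \<open>An iteration pays \<open>acost e + 3\<close> for the test and 4 for the increment, and
  the failing test at the end pays \<open>acost e + 3\<close> once more. The invariant receives the
  counter as an argument and must not depend on the register that holds it.\<close>

lemma wpt_For:
  assumes init: "I lo s" "reg s i = lo" "lo \<le> hi" "hi \<le> B"
    and indep: "\<And>j s z. I j s \<Longrightarrow> I j (s\<lparr>reg := (reg s)(i := z)\<rparr>)"
    and step: "\<And>j s'. lo \<le> j \<Longrightarrow> j < hi \<Longrightarrow> I j s' \<Longrightarrow> reg s' i = j \<Longrightarrow>
      frame (For i e c) s s' \<Longrightarrow> wpt B c (\<lambda>t s''. t \<le> tb j \<and> I (Suc j) s'') s'"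
    and bound: "\<And>j s'. I j s' \<Longrightarrow> frame (For i e c) s s' \<Longrightarrow> aval e s' = hi"
    and notin: "i \<notin> wregs c"
    and post: "\<And>t s'. I hi s' \<Longrightarrow> reg s' i = hi \<Longrightarrow> frame (For i e c) s s' \<Longrightarrow>
      t \<le> (\<Sum>j=lo..<hi. tb j + acost e + 7) + acost e + 3 \<Longrightarrow> Q t s'"
  shows "wpt B (For i e c) Q s"
proof -
  let ?I = "\<lambda>s'. lo \<le> reg s' i \<and> reg s' i \<le> hi \<and> I (reg s' i) s' \<and> frame (For i e c) s s'"
  let ?\<Phi> = "\<lambda>s'. \<Sum>j=reg s' i..<hi. tb j + acost e + 7"
  show ?thesis
    unfolding For_def
  proof (rule wpt_While[where I = ?I and \<Phi> = ?\<Phi>])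
    show "?I s" using init by simp
  next
    fix s' assume I: "?I s'" and b: "bval (Less (V i) e) s'"
    have e: "aval e s' = hi" using bound I by blast
    then have lt: "reg s' i < hi" using b by simp
    have "wpt B c (\<lambda>t s''. t \<le> tb (reg s' i) \<and> I (Suc (reg s' i)) s'') s'"
      using step I lt by blast
    then have "wpt B c (\<lambda>t s''. t \<le> tb (reg s' i) \<and> I (Suc (reg s' i)) s'' \<and>
        frame c s' s'' \<and> reg s'' i = reg s' i) s'"
      by (rule wpt_frame) (auto dest: frame_reg[OF _ notin])
    then show "wpt B (Seq c (Assign i (Plus (V i) (N 1))))
        (\<lambda>t s''. ?I s'' \<and> 1 + bcost (Less (V i) e) + t + ?\<Phi> s'' \<le> ?\<Phi> s') s'"
      unfolding wpt_Seq
    proof (rule wpt_mono, goal_cases)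
      case (1 t s'')
      have "frame (For i e c) s' (s''\<lparr>reg := (reg s'')(i := z)\<rparr>)" for z
        using 1 by (simp add: frame_def)
      then have "frame (For i e c) s (s''\<lparr>reg := (reg s'')(i := z)\<rparr>)" for z
        using I frame_trans by blast
      moreover have "(\<Sum>j=reg s' i..<hi. tb j + acost e + 7) =
          tb (reg s' i) + acost e + 7 + (\<Sum>j=Suc (reg s' i)..<hi. tb j + acost e + 7)"
        using lt by (rule sum.atLeast_Suc_lessThan)
      ultimately show ?case
        using 1 I lt init(4) indep by (simp add: Suc_le_eq)
    qed
  next
    fix t s' assume I: "?I s'" and b: "\<not> bval (Less (V i) e) s'"
      and t: "t + ?\<Phi> s' \<le> ?\<Phi> s + 1 + bcost (Less (V i) e)"
    have "aval e s' = hi" using bound I by blast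
    then have "reg s' i = hi" using b I by simp
    then show "Q t s'" using post I t init by simp
  qed
qed

section \<open>Adjacency lists in memory\<close>

definition AdjLoop :: "string \<Rightarrow> com \<Rightarrow> com" where
  "AdjLoop x c =
     Seq (Assign ''e'' (Arr ''off'' (V x)))
       (For ''e'' (Arr ''off'' (Plus (V x) (N 1)))
         (Seq (Assign ''u'' (Arr ''adj'' (V ''e''))) c))"

lemma wregs_AdjLoop [simp]: "wregs (AdjLoop x c) = {''e'', ''u''} \<union> wregs c"
  and warrs_AdjLoop [simp]: "warrs (AdjLoop x c) = warrs c"
  by (auto simp: AdjLoop_def)

locale graph_input =
  fixes L :: "nat list list" and B :: nat
  assumes distinct_lists: "v < length L \<Longrightarrow> distinct (L ! v)"
    and lists_subset: "v < length L \<Longrightarrow> set (L ! v) \<subseteq> {..<length L}"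
    and B_ge: "(length L + 2) ^ 3 \<le> B"
begin

definition n where "n = length L"
definition E where "E = {(u, v). u < n \<and> v \<in> set (L ! u)}"
definition A where "A = length (concat L)"

definition inp :: "state \<Rightarrow> bool" where
  "inp s \<longleftrightarrow> reg s ''n'' = n \<and> arr s ''off'' = arr (initial_state L) ''off'' \<and>
     arr s ''adj'' = arr (initial_state L) ''adj''"

lemma inp_n: "inp s \<Longrightarrow> reg s ''n'' = n"
  by (simp add: inp_def)

lemma inp_off: "inp s \<Longrightarrow> v \<le> n \<Longrightarrow> arr s ''off'' v = length (concat (take v L))"
  by (simp add: inp_def initial_state_def n_def)

lemma inp_off_Suc:
  "inp s \<Longrightarrow> v < n \<Longrightarrow> arr s ''off'' (Suc v) = arr s ''off'' v + length (L ! v)"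
  by (simp add: inp_off n_def take_Suc_conv_app_nth)

lemma inp_off_n: "inp s \<Longrightarrow> arr s ''off'' n = A"
  by (simp add: inp_off A_def) (simp add: n_def)

lemma inp_adj:
  assumes "inp s" "v < n" "k < length (L ! v)"
  shows "arr s ''adj'' (arr s ''off'' v + k) = L ! v ! k"
proof -
  have L: "L = take v L @ L ! v # drop (Suc v) L"
    using assms(2) by (simp add: n_def id_take_nth_drop)
  have "concat L = concat (take v L) @ L ! v @ concat (drop (Suc v) L)"
    by (subst L) simp
  then have "concat L ! (length (concat (take v L)) + k) = L ! v ! k"
    "length (concat (take v L)) + k < length (concat L)"
    using assms(3) by (simp_all add: nth_append)
  then show ?thesis using assms by (simp add: inp_off) (simp add: inp_def initial_state_def)
qed

lemma inp_frame:
  "inp s \<Longrightarrow> frame c s s' \<Longrightarrow> ''n'' \<notin> wregs c \<Longrightarrow> ''off'' \<notin> warrs c \<Longrightarrow> ''adj'' \<notin> warrs c \<Longrightarrow> inp s'"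
  by (simp add: inp_def frame_def)

lemma length_list_le: "v < n \<Longrightarrow> length (L ! v) \<le> n"
  using card_mono[OF _ lists_subset[of v]] distinct_lists[of v]
  by (simp add: n_def distinct_card[symmetric])

lemma A_eq: "A = (\<Sum>v<n. length (L ! v))"
  by (simp add: A_def n_def length_concat sum_list_sum_nth atLeast0LessThan)

lemma A_le: "A \<le> n * n"
proof -
  have "A \<le> (\<Sum>v<n. n)" unfolding A_eq by (rule sum_mono) (simp add: length_list_le)
  then show ?thesis by simp
qed

text \<open>The largest numbers in memory are positions in \<open>adj\<close>, at most
  \<open>n * n\<close>, and the square computed for the degree threshold.\<close>

lemma B_bounds: "n + 2 \<le> B" "(n + 2) * (n + 2) \<le> B" "A \<le> B"
proof -
  have "(n + 2) * (n + 2) * 1 \<le> (n + 2) * (n + 2) * (n + 2)"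
    by (rule mult_le_mono2) simp
  then show 2: "(n + 2) * (n + 2) \<le> B"
    using B_ge by (simp add: n_def power3_eq_cube)
  show "n + 2 \<le> B" using 2 by simp
  show "A \<le> B" using 2 A_le by simp
qed

lemma off_le: "inp s \<Longrightarrow> v \<le> n \<Longrightarrow> arr s ''off'' v \<le> B"
  using B_bounds(3) A_def length_append[of "concat (take v L)" "concat (drop v L)"]
  by (simp add: inp_off flip: concat_append)

text \<open>The overhead of 14 per entry is 7 for the loop, 4 for reading the end of the list and 3
  for loading \<open>u\<close>. The invariant counts list entries, whereas the register
  \<open>e\<close> holds absolute positions.\<close>

lemma wpt_AdjLoop:
  assumes s: "inp s" "reg s x = v" "v < n"
    and init: "I 0 s"
    and indep: "\<And>k s y z. I k s \<Longrightarrow> y \<in> {''e'', ''u''} \<Longrightarrow> I k (s\<lparr>reg := (reg s)(y := z)\<rparr>)"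
    and notin: "x \<notin> wregs c" "x \<noteq> ''e''" "x \<noteq> ''u''" "''e'' \<notin> wregs c"
      "''off'' \<notin> warrs c" "''adj'' \<notin> warrs c"
    and step: "\<And>k s'. k < length (L ! v) \<Longrightarrow> I k s' \<Longrightarrow> reg s' ''u'' = L ! v ! k \<Longrightarrow>
      frame (AdjLoop x c) s s' \<Longrightarrow> wpt B c (\<lambda>t s''. t \<le> tb \<and> I (Suc k) s'') s'"
    and post: "\<And>t s'. I (length (L ! v)) s' \<Longrightarrow> frame (AdjLoop x c) s s' \<Longrightarrow>
      t \<le> length (L ! v) * (tb + 14) + 10 \<Longrightarrow> Q t s'"
  shows "wpt B (AdjLoop x c) Q s"
proof -
  let ?o = "arr s ''off'' v"
  let ?s = "s\<lparr>reg := (reg s)(''e'' := ?o)\<rparr>"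
  let ?hi = "Arr ''off'' (Plus (V x) (N 1))"
  let ?c = "Seq (Assign ''u'' (Arr ''adj'' (V ''e''))) c"
  have hi: "?o + length (L ! v) = arr s ''off'' (Suc v)" using s by (simp add: inp_off_Suc)
  have fr: "frame (AdjLoop x c) s s'" if "frame (For ''e'' ?hi ?c) ?s s'" for s'
    using that by (auto simp: frame_def)
  have loop: "wpt B (For ''e'' ?hi ?c) (\<lambda>t. Q (3 + t)) ?s"
  proof (rule wpt_For[where I = "\<lambda>j. I (j - ?o)" and lo = ?o and hi = "?o + length (L ! v)"
        and tb = "\<lambda>_. tb + 3"])
    show "I (?o - ?o) ?s" using indep[of 0 s "''e''"] init by simp
    show "reg ?s ''e'' = ?o" by simp
    show "?o + length (L ! v) \<le> B" using hi off_le[of s "Suc v"] s by simp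
    show "I (j - ?o) (s'\<lparr>reg := (reg s')(''e'' := z)\<rparr>)" if "I (j - ?o) s'" for j s' z
      using indep that by simp
    show "''e'' \<notin> wregs ?c" using notin by simp
    show "aval ?hi s' = ?o + length (L ! v)" if "frame (For ''e'' ?hi ?c) ?s s'" for s'
      using that s hi notin by (simp add: frame_def)
  next
    fix j s' assume j: "?o \<le> j" "j < ?o + length (L ! v)" and I: "I (j - ?o) s'"
      and e: "reg s' ''e'' = j" and f: "frame (For ''e'' ?hi ?c) ?s s'"
    let ?s' = "s'\<lparr>reg := (reg s')(''u'' := L ! v ! (j - ?o))\<rparr>"
    have adj: "arr s' ''adj'' j = L ! v ! (j - ?o)"
      using inp_adj[OF s(1,3), of "j - ?o"] j f notin by (simp add: frame_def)
    have "L ! v ! (j - ?o) < n"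
      using lists_subset[of v] s j by (simp add: n_def subset_iff)
    then have le: "L ! v ! (j - ?o) \<le> B" using B_bounds by simp
    have "wpt B c (\<lambda>t s''. t \<le> tb \<and> I (Suc (j - ?o)) s'') ?s'"
    proof (rule step)
      show "j - ?o < length (L ! v)" using j by linarith
      show "I (j - ?o) ?s'" using indep[OF I] by simp
      show "frame (AdjLoop x c) s ?s'" using fr[OF f] by (simp add: frame_def)
    qed simp
    then have "wpt B c (\<lambda>t s''. 3 + t \<le> tb + 3 \<and> I (Suc j - ?o) s'') ?s'"
      by (rule wpt_mono) (use j in \<open>simp add: Suc_diff_le\<close>)
    then show "wpt B ?c (\<lambda>t s''. t \<le> tb + 3 \<and> I (Suc j - ?o) s'') s'"
      using le by (simp add: adj e)
  next
    fix t s' assume "I (?o + length (L ! v) - ?o) s'" "frame (For ''e'' ?hi ?c) ?s s'"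
      "t \<le> (\<Sum>j=?o..<?o + length (L ! v). tb + 3 + acost ?hi + 7) + acost ?hi + 3"
    then show "Q (3 + t) s'" using post fr by (simp add: algebra_simps)
  qed simp
  show ?thesis
    unfolding AdjLoop_def using loop s off_le[of s v] by (simp add: numeral_3_eq_3)
qed

section \<open>Invariant of the queue-based search\<close>

definition is_queue :: "nat list \<Rightarrow> state \<Rightarrow> bool" where
  "is_queue Qs s \<longleftrightarrow> reg s ''t'' = length Qs \<and> (\<forall>i<length Qs. arr s ''q'' i = Qs ! i) \<and>
     (\<forall>u<n. arr s ''seen'' u = of_bool (u \<in> set Qs))"

text \<open>\<open>Qs\<close> is the queue, of which the first \<open>h\<close> entries have been processed, \<open>D\<close> the set of
  expanded vertices. If \<open>k0 > 0\<close>, no vertex is rejected and the search is a breadth-first search.\<close>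

definition search_inv ::
    "nat \<Rightarrow> nat set \<Rightarrow> nat \<Rightarrow> nat list \<Rightarrow> nat \<Rightarrow> nat set \<Rightarrow> (nat \<Rightarrow> nat) \<Rightarrow> bool" where
  "search_inv r C k0 Qs h D d \<longleftrightarrow>
     (distinct Qs \<and> set Qs \<subseteq> {..<n} \<and> Qs \<noteq> [] \<and> Qs ! 0 = r \<and> h \<le> length Qs) \<and>
     (D \<subseteq> set (take h Qs) \<and> set Qs = insert r (E `` D) \<and> (\<forall>v\<in>D. (r, v) \<in> (E \<inter> D \<times> D)\<^sup>*)) \<and>
     ((k0 = 0 \<and> D \<noteq> {} \<longrightarrow> C - set Qs \<noteq> {}) \<and>
      (\<forall>s\<in>set (take h Qs) - D. k0 = 0 \<and> C - set Qs \<subseteq> E `` {s})) \<and>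
     (d r = 0 \<and> (\<forall>v\<in>set Qs - {r}. \<exists>u\<in>D. (u, v) \<in> E \<and> d v = Suc (d u)) \<and>
      (\<forall>u\<in>D. \<forall>v. (u, v) \<in> E \<longrightarrow> d v \<le> Suc (d u))) \<and>
     ((\<forall>i<length Qs. d (Qs ! i) \<le> i) \<and> sorted (map d Qs) \<and>
      (h < length Qs \<longrightarrow> (\<forall>v\<in>set Qs. d v \<le> Suc (d (Qs ! h)))))"

lemma search_invD:
  assumes "search_inv r C k0 Qs h D d"
  shows "distinct Qs" "set Qs \<subseteq> {..<n}" "Qs \<noteq> []" "Qs ! 0 = r" "h \<le> length Qs"
    "D \<subseteq> set (take h Qs)" "set Qs = insert r (E `` D)" "\<forall>v\<in>D. (r, v) \<in> (E \<inter> D \<times> D)\<^sup>*"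
    "k0 = 0 \<and> D \<noteq> {} \<longrightarrow> C - set Qs \<noteq> {}"
    "\<forall>s\<in>set (take h Qs) - D. k0 = 0 \<and> C - set Qs \<subseteq> E `` {s}"
    "d r = 0" "\<forall>v\<in>set Qs - {r}. \<exists>u\<in>D. (u, v) \<in> E \<and> d v = Suc (d u)"
    "\<forall>u\<in>D. \<forall>v. (u, v) \<in> E \<longrightarrow> d v \<le> Suc (d u)"
    "\<forall>i<length Qs. d (Qs ! i) \<le> i" "sorted (map d Qs)"
    "h < length Qs \<longrightarrow> (\<forall>v\<in>set Qs. d v \<le> Suc (d (Qs ! h)))"
  using assms unfolding search_inv_def by - (elim conjE, assumption)+

lemma search_inv_init:
  assumes "r < n" "d r = 0"
  shows "search_inv r C k0 [r] 0 {} d"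
  using assms by (simp add: search_inv_def)

lemma sorted_head:
  assumes "sorted (map d Qs)" "Suc h < length Qs"
  shows "d (Qs ! h) \<le> d (Qs ! Suc h)"
  using sorted_nth_mono[OF assms(1), of h "Suc h"] assms(2) by simp

lemma search_inv_reject:
  assumes inv: "search_inv r C k0 Qs h D d" and h: "h < length Qs"
    and rej: "k0 = 0" "C - set Qs \<subseteq> E `` {Qs ! h}"
  shows "search_inv r C k0 Qs (Suc h) D d"
proof -
  have tk: "set (take (Suc h) Qs) = insert (Qs ! h) (set (take h Qs))"
    using h by (simp add: take_Suc_conv_app_nth)
  note P = search_invD(1-10)[OF inv] and f = search_invD(14-16)[OF inv]
  have P4: "d r = 0 \<and> (\<forall>v\<in>set Qs - {r}. \<exists>u\<in>D. (u, v) \<in> E \<and> d v = Suc (d u)) \<and>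
      (\<forall>u\<in>D. \<forall>v. (u, v) \<in> E \<longrightarrow> d v \<le> Suc (d u))"
    by (intro conjI search_invD(11-13)[OF inv])
  have P1: "distinct Qs \<and> set Qs \<subseteq> {..<n} \<and> Qs \<noteq> [] \<and> Qs ! 0 = r \<and> Suc h \<le> length Qs"
    using P h by simp
  have P2: "D \<subseteq> set (take (Suc h) Qs) \<and> set Qs = insert r (E `` D) \<and>
      (\<forall>v\<in>D. (r, v) \<in> (E \<inter> D \<times> D)\<^sup>*)"
    unfolding tk using P(6) by (intro conjI P(7,8)) blast
  have P3: "(k0 = 0 \<and> D \<noteq> {} \<longrightarrow> C - set Qs \<noteq> {}) \<and>
      (\<forall>s\<in>set (take (Suc h) Qs) - D. k0 = 0 \<and> C - set Qs \<subseteq> E `` {s})"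
    unfolding tk using P(10) rej by (intro conjI P(9)) blast
  have P5: "(\<forall>i<length Qs. d (Qs ! i) \<le> i) \<and> sorted (map d Qs) \<and>
      (Suc h < length Qs \<longrightarrow> (\<forall>v\<in>set Qs. d v \<le> Suc (d (Qs ! Suc h))))"
  \<comment> \<open>Levels are sorted along the queue, so advancing the head cannot tighten the
    bound.\<close>
  proof (intro conjI impI ballI)
    fix v assume "Suc h < length Qs" "v \<in> set Qs"
    then have "d (Qs ! h) \<le> d (Qs ! Suc h)" "d v \<le> Suc (d (Qs ! h))"
      using sorted_head[OF f(2)] f(3) h by simp_all
    then show "d v \<le> Suc (d (Qs ! Suc h))" by linarith
  qed (use f in simp_all)
  show ?thesis
    unfolding search_inv_def by (rule conjI[OF P1 conjI[OF P2 conjI[OF P3 conjI[OF P4 P5]]]])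
qed

text \<open>New vertices get one level above the head, the highest level present by the last clause
  of the invariant. So the queue stays sorted, as in every breadth-first search, even though some
  vertices are never expanded.\<close>

lemma search_inv_accept:
  assumes inv: "search_inv r C k0 Qs h D d" and h: "h < length Qs"
    and new: "distinct new" "set new = E `` {Qs ! h} - set Qs" "set new \<subseteq> {..<n}"
    and acc: "k0 = 0 \<Longrightarrow> C - set Qs - set new \<noteq> {}"
    and d': "\<And>u. d' u = (if u \<in> set new then Suc (d (Qs ! h)) else d u)"
  shows "search_inv r C k0 (Qs @ new) (Suc h) (insert (Qs ! h) D) d'"
proof -
  let ?v = "Qs ! h" and ?D = "insert (Qs ! h) D"
  note a = search_invD(1-4)[OF inv] and b = search_invD(6-8)[OF inv]
    and c = search_invD(10)[OF inv] and e = search_invD(11-13)[OF inv]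
    and f = search_invD(14-16)[OF inv]
  have vQ: "?v \<in> set Qs" using h by simp
  have rQ: "r \<in> set Qs" using b by blast
  have DQ: "D \<subseteq> set Qs" using b(1) set_take_subset[of h Qs] by (rule subset_trans)
  have old: "d' u = d u" if "u \<in> set Qs" for u
  proof -
    have "u \<notin> set new" using that new(2) by blast
    then show ?thesis by (simp add: d')
  qed
  have "set (Qs @ new) = set Qs \<union> E `` {?v}"
    unfolding set_append new(2) by (rule Un_Diff_cancel)
  also have "\<dots> = insert r (E `` ?D)" unfolding b(2) by blast
  finally have eq: "set (Qs @ new) = insert r (E `` ?D)" .
  have tk: "set (take (Suc h) (Qs @ new)) = insert ?v (set (take h Qs))"
    using h by (simp add: take_Suc_conv_app_nth)
  have mono: "(E \<inter> D \<times> D)\<^sup>* \<subseteq> (E \<inter> ?D \<times> ?D)\<^sup>*" by (rule rtrancl_mono) auto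
  have "(r, ?v) \<in> (E \<inter> ?D \<times> ?D)\<^sup>*"
  proof (cases "?v = r")
    case False
    then obtain u where u: "u \<in> D" "(u, ?v) \<in> E" using b(2) vQ by blast
    then have "(r, u) \<in> (E \<inter> ?D \<times> ?D)\<^sup>*" using b(3) mono by blast
    moreover have "(u, ?v) \<in> E \<inter> ?D \<times> ?D" using u by blast
    ultimately show ?thesis by (rule rtrancl_into_rtrancl)
  qed simp
  then have conn: "\<forall>v\<in>?D. (r, v) \<in> (E \<inter> ?D \<times> ?D)\<^sup>*" using b(3) mono by blast
  have P1: "distinct (Qs @ new) \<and> set (Qs @ new) \<subseteq> {..<n} \<and> Qs @ new \<noteq> [] \<and>
      (Qs @ new) ! 0 = r \<and> Suc h \<le> length (Qs @ new)"
    using a new h by (auto simp: nth_append)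
  have P2: "?D \<subseteq> set (take (Suc h) (Qs @ new)) \<and> set (Qs @ new) = insert r (E `` ?D) \<and>
      (\<forall>v\<in>?D. (r, v) \<in> (E \<inter> ?D \<times> ?D)\<^sup>*)"
    unfolding tk using b(1) by (intro conjI eq conn) blast
  \<comment> \<open>The unreached candidates only become fewer, so earlier rejections remain
    justified.\<close>
  have sub: "C - set (Qs @ new) \<subseteq> C - set Qs" by auto
  have P3: "(k0 = 0 \<and> ?D \<noteq> {} \<longrightarrow> C - set (Qs @ new) \<noteq> {}) \<and>
      (\<forall>s\<in>set (take (Suc h) (Qs @ new)) - ?D. k0 = 0 \<and> C - set (Qs @ new) \<subseteq> E `` {s})"
  proof (intro conjI ballI impI)
    show "C - set (Qs @ new) \<noteq> {}" if "k0 = 0 \<and> ?D \<noteq> {}"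
      using acc that by auto
    fix s assume "s \<in> set (take (Suc h) (Qs @ new)) - ?D"
    then have "s \<in> set (take h Qs) - D" using tk by auto
    then have "k0 = 0" "C - set Qs \<subseteq> E `` {s}" using c by blast+
    then show "k0 = 0" "C - set (Qs @ new) \<subseteq> E `` {s}" using sub by blast+
  qed
  have P4: "d' r = 0 \<and> (\<forall>v\<in>set (Qs @ new) - {r}. \<exists>u\<in>?D. (u, v) \<in> E \<and> d' v = Suc (d' u)) \<and>
      (\<forall>u\<in>?D. \<forall>v. (u, v) \<in> E \<longrightarrow> d' v \<le> Suc (d' u))"
  proof (intro conjI ballI allI impI)
    show "d' r = 0" using old rQ e(1) by simp
  next
    fix v assume v: "v \<in> set (Qs @ new) - {r}"
    show "\<exists>u\<in>?D. (u, v) \<in> E \<and> d' v = Suc (d' u)"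
    proof (cases "v \<in> set new")
      case True
      then have "(?v, v) \<in> E" "d' v = Suc (d' ?v)" using new(2) d' old[OF vQ] by auto
      then show ?thesis by blast
    next
      case False
      then have vQ': "v \<in> set Qs - {r}" using v by simp
      then obtain u where u: "u \<in> D" "(u, v) \<in> E" "d v = Suc (d u)" using e(2) by blast
      have "d' u = d u" "d' v = d v" using u(1) DQ vQ' by (auto intro!: old)
      then show ?thesis using u by auto
    qed
  next
    fix u v assume u: "u \<in> ?D" and uv: "(u, v) \<in> E"
    have vin: "v \<in> set (Qs @ new)" using eq u uv by blast
    have uQ: "u \<in> set Qs" using u DQ vQ by blast
    show "d' v \<le> Suc (d' u)"
    proof (cases "v \<in> set Qs")
      case True
      show ?thesis
      proof (cases "u \<in> D")
        case True
        then have "d v \<le> Suc (d u)" using e(3) uv by blast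
        then show ?thesis using old uQ \<open>v \<in> set Qs\<close> by simp
      next
        case False
        then have "u = ?v" using u by blast
        then show ?thesis using f(3) h True old uQ by simp
      qed
    next
      case False
      \<comment> \<open>Arcs out of vertices expanded before end in \<open>Qs\<close>.\<close>
      then have "u = ?v" using u uv b(2) by blast
      then show ?thesis using False d' old[OF vQ] vin by simp
    qed
  qed
  have mx: "d' v \<le> Suc (d ?v)" if "v \<in> set (Qs @ new)" for v
  proof (cases "v \<in> set new")
    case True
    then show ?thesis using d'[of v] by simp
  next
    case False
    then have "v \<in> set Qs" using that by simp
    then show ?thesis using f(3) h old by simp
  qed
  have P5: "(\<forall>i<length (Qs @ new). d' ((Qs @ new) ! i) \<le> i) \<and> sorted (map d' (Qs @ new)) \<and>
      (Suc h < length (Qs @ new) \<longrightarrow> (\<forall>v\<in>set (Qs @ new). d' v \<le> Suc (d' ((Qs @ new) ! Suc h))))"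
  proof (intro conjI allI impI ballI)
    fix i assume i: "i < length (Qs @ new)"
    show "d' ((Qs @ new) ! i) \<le> i"
    proof (cases "i < length Qs")
      case True
      then show ?thesis using f(1) old by (simp add: nth_append)
    next
      case False
      \<comment> \<open>Bounding levels by queue positions keeps all stored distances below
        \<open>n\<close>, and thereby within the memory bound.\<close>
      have "d' ((Qs @ new) ! i) \<le> Suc (d ?v)" by (rule mx[OF nth_mem[OF i]])
      moreover have "d ?v \<le> h" using f(1) h by blast
      ultimately show ?thesis using h False by linarith
    qed
  next
    have 1: "map d' Qs = map d Qs" using old by simp
    have 2: "map d' new = map (\<lambda>_. Suc (d ?v)) new" using d' by simp
    have 3: "sorted (map (\<lambda>_. c) xs)" for c :: nat and xs :: "nat list"
      by (induction xs) auto
    show "sorted (map d' (Qs @ new))"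
      unfolding map_append 1 2 sorted_append using f(2,3) h 3 by auto
  next
    fix v assume Sh: "Suc h < length (Qs @ new)" and v: "v \<in> set (Qs @ new)"
    have "d ?v \<le> d' ((Qs @ new) ! Suc h)"
    proof (cases "Suc h < length Qs")
      case True
      then show ?thesis using sorted_head[OF f(2) True] old by (simp add: nth_append)
    next
      case False
      then have "(Qs @ new) ! Suc h \<in> set new" using Sh by (simp add: nth_append)
      then show ?thesis using d' by simp
    qed
    then show "d' v \<le> Suc (d' ((Qs @ new) ! Suc h))" using mx[OF v] by linarith
  qed
  show ?thesis
    unfolding search_inv_def by (rule conjI[OF P1 conjI[OF P2 conjI[OF P3 conjI[OF P4 P5]]]])
qed

end

section \<open>The filtered search as a program\<close>

definition count_body :: com where
  "count_body = Cond (Eq (Arr ''seen'' (V ''u'')) (N 0))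
     (Assign ''j'' (Plus (V ''j'') (Arr ''c'' (V ''u'')))) SKIP"

definition push_body :: com where
  "push_body = Cond (Eq (Arr ''seen'' (V ''u'')) (N 0))
     (Seq (Store ''seen'' (V ''u'') (N 1))
     (Seq (Store ''dist'' (V ''u'') (V ''D''))
     (Seq (Store ''q'' (V ''t'') (V ''u''))
          (Assign ''t'' (Plus (V ''t'') (N 1)))))) SKIP"

text \<open>Register \<open>k\<close> holds \<open>k0\<close> plus the number of unreached candidates, and \<open>j\<close> the number of
  candidates that expanding \<open>v\<close> would reach.\<close>

definition visit :: com where
  "visit =
     Seq (Assign ''v'' (Arr ''q'' (V ''h'')))
     (Seq (Assign ''h'' (Plus (V ''h'') (N 1)))
     (Seq (Assign ''j'' (N 0))
     (Seq (AdjLoop ''v'' count_body)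
          (Cond (Less (V ''j'') (V ''k''))
             (Seq (Store ''acc'' (V ''v'') (N 1))
             (Seq (Assign ''k'' (Minus (V ''k'') (V ''j'')))
             (Seq (Assign ''D'' (Plus (Arr ''dist'' (V ''v'')) (N 1)))
                  (AdjLoop ''v'' push_body))))
             SKIP))))"

text \<open>\<open>dist\<close> carries over between searches: it is meaningful at reached vertices,
  and a breadth-first search of a connected graph reaches all of them.\<close>

definition search :: com where
  "search =
     Seq (Assign ''i'' (N 0))
     (Seq (For ''i'' (V ''n'') (Seq (Store ''seen'' (V ''i'') (N 0)) (Store ''acc'' (V ''i'') (N 0))))
     (Seq (Store ''seen'' (V ''r'') (N 1))
     (Seq (Store ''dist'' (V ''r'') (N 0))
     (Seq (Store ''q'' (N 0) (V ''r''))
     (Seq (Assign ''h'' (N 0))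
     (Seq (Assign ''t'' (N 1))
     (Seq (Assign ''k'' (Minus (V ''k'') (Arr ''c'' (V ''r''))))
          (While (Less (V ''h'') (V ''t'')) visit))))))))"

lemma wregs_count_body [simp]: "wregs count_body = {''j''}" "warrs count_body = {}"
  and wregs_push_body [simp]: "wregs push_body = {''t''}" "warrs push_body = {''seen'', ''dist'', ''q''}"
  by (auto simp: count_body_def push_body_def)

lemma wregs_search [simp]: "wregs search = {''i'', ''h'', ''t'', ''k'', ''v'', ''j'', ''D'', ''e'', ''u''}"
    "warrs search = {''seen'', ''acc'', ''dist'', ''q''}"
  by (auto simp: search_def visit_def)

context graph_input
begin

definition cands :: "nat set \<Rightarrow> state \<Rightarrow> bool" where
  "cands C s \<longleftrightarrow> C \<subseteq> {..<n} \<and> (\<forall>u<n. arr s ''c'' u = of_bool (u \<in> C))"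

lemma cands_frame: "cands C s \<Longrightarrow> frame c s s' \<Longrightarrow> ''c'' \<notin> warrs c \<Longrightarrow> cands C s'"
  by (simp add: cands_def frame_def)

lemma card_le_n: "S \<subseteq> {..<n} \<Longrightarrow> card S \<le> n"
  using card_mono[of "{..<n}" S] by simp

lemma list_lt: "v < n \<Longrightarrow> k < length (L ! v) \<Longrightarrow> L ! v ! k < n"
  using lists_subset[of v] by (force simp: n_def subset_iff)

lemma list_subset: "v < n \<Longrightarrow> set (L ! v) \<subseteq> {..<n}"
  using lists_subset[of v] by (simp add: n_def)

lemma list_distinct: "v < n \<Longrightarrow> distinct (L ! v)"
  using distinct_lists[of v] by (simp add: n_def)

lemma wpt_count:
  assumes s: "inp s" "is_queue Qs s" "cands C s" "reg s ''v'' = v" "v < n" "reg s ''j'' = 0"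
    and post: "\<And>t s'. reg s' ''j'' = card (set (L ! v) \<inter> (C - set Qs)) \<Longrightarrow>
      frame (AdjLoop ''v'' count_body) s s' \<Longrightarrow> t \<le> length (L ! v) * 24 + 10 \<Longrightarrow> Q t s'"
  shows "wpt B (AdjLoop ''v'' count_body) Q s"
proof (rule wpt_AdjLoop[where I = "\<lambda>k s'. reg s' ''j'' = card (set (take k (L ! v)) \<inter> (C - set Qs))" and tb = 10,
      OF s(1,4,5)])
  fix k s'
  assume k: "k < length (L ! v)" and j: "reg s' ''j'' = card (set (take k (L ! v)) \<inter> (C - set Qs))"
    and u: "reg s' ''u'' = L ! v ! k" and f: "frame (AdjLoop ''v'' count_body) s s'"
  let ?x = "L ! v ! k"
  have seen: "arr s' ''seen'' ?x = of_bool (?x \<in> set Qs)" and c: "arr s' ''c'' ?x = of_bool (?x \<in> C)"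
    using f s list_lt[OF s(5) k] by (simp_all add: frame_def is_queue_def cands_def)
  have tk: "set (take (Suc k) (L ! v)) = insert ?x (set (take k (L ! v)))"
    using k by (simp add: take_Suc_conv_app_nth)
  have notin: "?x \<notin> set (take k (L ! v))"
    using list_distinct[OF s(5)] k
    by (metis id_take_nth_drop distinct_append disjoint_iff list.set_intros(1))
  have "card (set (take k (L ! v)) \<inter> (C - set Qs)) \<le> n"
    using s by (intro card_le_n) (auto simp: cands_def)
  then have le: "card (set (take k (L ! v)) \<inter> (C - set Qs)) + 1 \<le> B" using B_bounds by simp
  have ins: "insert ?x (set (take k (L ! v))) \<inter> (C - set Qs) =
      (if ?x \<in> C - set Qs then insert ?x (set (take k (L ! v)) \<inter> (C - set Qs))
       else set (take k (L ! v)) \<inter> (C - set Qs))" by auto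
  show "wpt B count_body (\<lambda>t s''. t \<le> 10 \<and>
      reg s'' ''j'' = card (set (take (Suc k) (L ! v)) \<inter> (C - set Qs))) s'"
    unfolding tk ins using le notin by (simp add: count_body_def u seen c j)
next
  fix t s'
  assume "reg s' ''j'' = card (set (take (length (L ! v)) (L ! v)) \<inter> (C - set Qs))"
    "frame (AdjLoop ''v'' count_body) s s'" "t \<le> length (L ! v) * (10 + 14) + 10"
  then show "Q t s'" using post by simp
qed (use s in auto)

lemma wpt_push:
  assumes s: "inp s" "is_queue Qs s" "reg s ''v'' = v" "v < n" "reg s ''D'' = D" "D \<le> n"
    and Qs: "distinct Qs" "set Qs \<subseteq> {..<n}"
    and d: "arr s ''dist'' = d"
    and post: "\<And>t s' new. new = filter (\<lambda>u. u \<notin> set Qs) (L ! v) \<Longrightarrow> is_queue (Qs @ new) s' \<Longrightarrow>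
      (\<And>u. arr s' ''dist'' u = (if u \<in> set new then D else d u)) \<Longrightarrow>
      frame (AdjLoop ''v'' push_body) s s' \<Longrightarrow> t \<le> length (L ! v) * 38 + 10 \<Longrightarrow> Q t s'"
  shows "wpt B (AdjLoop ''v'' push_body) Q s"
proof -
  let ?new = "\<lambda>k. filter (\<lambda>u. u \<notin> set Qs) (take k (L ! v))"
  let ?I = "\<lambda>k s'. is_queue (Qs @ ?new k) s' \<and>
      (\<forall>u. arr s' ''dist'' u = (if u \<in> set (?new k) then D else d u))"
  show ?thesis
  proof (rule wpt_AdjLoop[where I = ?I and tb = 24, OF s(1,3,4)])
    show "?I 0 s" using s d by simp
    show "?I k (s\<lparr>reg := (reg s)(y := z)\<rparr>)" if "?I k s" "y \<in> {''e'', ''u''}" for k s y z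
      using that by (auto simp: is_queue_def)
  next
    fix k s'
    assume k: "k < length (L ! v)" and I: "?I k s'"
      and u: "reg s' ''u'' = L ! v ! k" and f: "frame (AdjLoop ''v'' push_body) s s'"
    let ?x = "L ! v ! k"
    have x: "?x < n" using list_lt[OF s(4) k] .
    have notin: "?x \<notin> set (take k (L ! v))"
      using list_distinct[OF s(4)] k
      by (metis id_take_nth_drop distinct_append disjoint_iff list.set_intros(1))
    have new: "?new (Suc k) = ?new k @ (if ?x \<in> set Qs then [] else [?x])"
      using k by (simp add: take_Suc_conv_app_nth)
    have seen: "arr s' ''seen'' ?x = of_bool (?x \<in> set Qs)"
      using I x notin by (simp add: is_queue_def)
    have D: "reg s' ''D'' = D" using f s by (simp add: frame_def)
    have "distinct (Qs @ ?new k)"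
      using Qs list_distinct[OF s(4)] by auto
    then have "length (Qs @ ?new k) = card (set (Qs @ ?new k))" by (metis distinct_card)
    also have "\<dots> \<le> n"
      using Qs list_subset[OF s(4)] set_take_subset[of k "L ! v"] by (intro card_le_n) auto
    finally have t: "length Qs + length (?new k) \<le> n" by simp
    have regt: "reg s' ''t'' = length Qs + length (?new k)" using I by (simp add: is_queue_def)
    show "wpt B push_body (\<lambda>t s''. t \<le> 24 \<and> ?I (Suc k) s'') s'"
    proof (cases "?x \<in> set Qs")
      case True
      then show ?thesis unfolding new using I by (simp add: push_body_def u seen)
    next
      case False
      have "is_queue (Qs @ ?new k @ [?x])
         (s'\<lparr>arr := (arr s')(''seen'' := (arr s' ''seen'')(?x := 1), ''dist'' := dd,
             ''q'' := (arr s' ''q'')(length Qs + length (?new k) := ?x)),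
            reg := (reg s')(''t'' := Suc (length Qs + length (?new k)))\<rparr>)" for dd
        using I unfolding is_queue_def by (auto simp: nth_append less_Suc_eq)
      then show ?thesis
        unfolding new using I False x s(6) t B_bounds(1)
        by (simp add: push_body_def u seen D regt)
    qed
  next
    fix t s'
    assume "?I (length (L ! v)) s'" "frame (AdjLoop ''v'' push_body) s s'"
      "t \<le> length (L ! v) * (24 + 14) + 10"
    then show "Q t s'" using post[OF refl, of s' t] by simp
  qed auto
qed


definition search_state ::
    "nat \<Rightarrow> nat set \<Rightarrow> nat \<Rightarrow> nat list \<Rightarrow> nat set \<Rightarrow> state \<Rightarrow> bool" where
  "search_state r C k0 Qs D s \<longleftrightarrow>
     inp s \<and> cands C s \<and> is_queue Qs s \<and> (\<forall>u<n. arr s ''acc'' u = of_bool (u \<in> D)) \<and>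
     search_inv r C k0 Qs (reg s ''h'') D (arr s ''dist'') \<and>
     reg s ''k'' = k0 + card (C - set Qs)"

text \<open>Every vertex that has not left the queue prepays its visit: 24 and 38 per neighbour for
  the counting and the pushing pass, and 60 for everything else.\<close>

definition search_potential :: "state \<Rightarrow> nat" where
  "search_potential s = (\<Sum>v\<in>{..<n} - arr s ''q'' ` {..<reg s ''h''}. length (L ! v) * 62 + 60)"

lemma queue_image:
  assumes "is_queue Qs s" "h \<le> length Qs"
  shows "arr s ''q'' ` {..<h} = set (take h Qs)"
proof -
  have "arr s ''q'' ` {..<h} = (!) Qs ` {0..<h}"
    using assms by (intro image_cong) (auto simp: is_queue_def)
  then show ?thesis using nth_image[OF assms(2)] by simp
qed

lemma search_potential_step:
  assumes "is_queue Qs s" "is_queue (Qs @ new) s'" "distinct Qs" "set Qs \<subseteq> {..<n}"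
    and "reg s ''h'' = h" "h < length Qs" "reg s' ''h'' = Suc h"
  shows "search_potential s' + (length (L ! (Qs ! h)) * 62 + 60) = search_potential s"
proof -
  let ?f = "\<lambda>v. length (L ! v) * 62 + 60" and ?P = "set (take h Qs)"
  have "Qs ! h \<notin> ?P"
    using assms(3,6) by (metis id_take_nth_drop distinct_append disjoint_iff list.set_intros(1))
  moreover have "Qs ! h < n" using assms by force
  ultimately have "Qs ! h \<in> {..<n} - ?P" by simp
  moreover have "set (take (Suc h) (Qs @ new)) = insert (Qs ! h) ?P"
    using assms by (simp add: take_Suc_conv_app_nth)
  moreover have "{..<n} - insert (Qs ! h) ?P = {..<n} - ?P - {Qs ! h}" by blast
  ultimately show ?thesis
    using queue_image[OF assms(1), of h] queue_image[OF assms(2), of "Suc h"] assms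
      sum.remove[of "{..<n} - ?P" "Qs ! h" ?f]
    unfolding search_potential_def by simp
qed

lemma wpt_visit:
  assumes s: "search_state r C k0 Qs D s" and h: "reg s ''h'' < reg s ''t''"
    and k0: "k0 + card C \<le> B"
  shows "wpt B visit (\<lambda>t s'. (\<exists>Qs D. search_state r C k0 Qs D s') \<and>
    4 + t + search_potential s' \<le> search_potential s) s"
proof -
  let ?h = "reg s ''h''"
  let ?v = "Qs ! ?h"
  let ?S = "set (L ! ?v)"
  have inp: "inp s" and cands: "cands C s" and Q: "is_queue Qs s"
    and acc: "\<forall>u<n. arr s ''acc'' u = of_bool (u \<in> D)"
    and inv: "search_inv r C k0 Qs ?h D (arr s ''dist'')"
    and k: "reg s ''k'' = k0 + card (C - set Qs)"
    using s unfolding search_state_def by auto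
  have hlen: "?h < length Qs" using h Q by (simp add: is_queue_def)
  have q: "arr s ''q'' ?h = ?v" using Q hlen by (simp add: is_queue_def)
  note Qs = search_invD(1,2)[OF inv]
  have v: "?v < n" using Qs hlen by force
  have len: "length Qs \<le> n" using Qs card_le_n[of "set Qs"] distinct_card[of Qs] by simp
  have dv: "arr s ''dist'' ?v < n" using search_invD(14)[OF inv] hlen len by force
  have fin: "finite C" using cands finite_subset unfolding cands_def by blast
  have kB: "reg s ''k'' \<le> B"
    using k k0 card_mono[OF fin, of "C - set Qs"] by force
  have Ev: "E `` {?v} = ?S" using v by (auto simp: E_def)
  let ?s1 = "s\<lparr>reg := (reg s)(''v'' := ?v, ''h'' := Suc ?h, ''j'' := 0)\<rparr>"
  have pot: "search_potential s' + (length (L ! ?v) * 62 + 60) = search_potential s"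
    if "is_queue (Qs @ new) s'" "reg s' ''h'' = Suc ?h" for s' new
    using search_potential_step[OF Q that(1) Qs refl hlen that(2)] .
  show ?thesis
    unfolding visit_def
  proof (simp add: q, intro conjI, goal_cases)
    case 1
    show ?case using v B_bounds by simp
  next
    case 2
    show ?case using hlen len B_bounds by simp
  next
    case 3
    show ?case
    proof (rule wpt_count[where Qs = Qs and C = C and v = ?v], goal_cases)
      case (7 t s')
      note j = 7(1) and f = 7(2) and t = 7(3)
      have eqs: "reg s' ''v'' = ?v" "reg s' ''h'' = Suc ?h" "reg s' ''k'' = reg s ''k''"
          "reg s' ''t'' = reg s ''t''"
          "\<And>a. arr s' a = arr s a"
        using f by (simp_all add: frame_def)
      have inp': "inp s'" using inp_frame[OF _ f] inp by (simp add: inp_def)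
      have cands': "cands C s'" and Q': "is_queue Qs s'"
        using cands Q by (simp_all add: cands_def is_queue_def eqs)
      have dec: "C - set Qs - (?S - set Qs) = C - set Qs - ?S \<inter> (C - set Qs)" by blast
      have card_dec: "card (C - set Qs - ?S \<inter> (C - set Qs)) =
          card (C - set Qs) - card (?S \<inter> (C - set Qs))"
        using fin by (intro card_Diff_subset) auto
      have rejected: "(\<exists>Qs D. search_state r C k0 Qs D s') \<and>
          search_potential s' + (length (L ! ?v) * 62 + 60) = search_potential s"
        if not: "\<not> reg s' ''j'' < reg s' ''k''"
      proof -
        \<comment> \<open>\<open>j\<close> counts some of the unreached candidates and
          \<open>k\<close> counts all of them plus \<open>k0\<close>. So a failed test forces
          \<open>k0 = 0\<close> and every unreached candidate to be a neighbour.\<close>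
        have rej: "card (C - set Qs) + k0 \<le> card (?S \<inter> (C - set Qs))"
          using not by (simp add: j eqs k)
        have le: "card (?S \<inter> (C - set Qs)) \<le> card (C - set Qs)"
          using fin by (intro card_mono) auto
        have "?S \<inter> (C - set Qs) = C - set Qs"
          using fin rej le by (intro card_subset_eq) auto
        then have "C - set Qs \<subseteq> E `` {?v}" "k0 = 0" using Ev rej le by auto
        then have "search_inv r C k0 Qs (Suc ?h) D (arr s ''dist'')"
          using search_inv_reject[OF inv hlen] by blast
        then have "search_state r C k0 Qs D s'"
          unfolding search_state_def using inp' cands' Q' acc k by (simp add: eqs)
        moreover have "search_potential s' + (length (L ! ?v) * 62 + 60) = search_potential s"
          using pot[of "[]" s'] Q' eqs by simp
        ultimately show ?thesis by blast
      qed
      show ?case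
      proof (simp, intro conjI impI, goal_cases)
        case 1
        show ?case using v B_bounds by (simp add: eqs)
      next
        case 2
        show ?case using B_bounds by simp
      next
        case 3
        show ?case using kB eqs by simp
      next
        case 4
        show ?case using dv B_bounds by (simp add: eqs)
      next
        case 5
        show ?case
        proof (rule wpt_push[where Qs = Qs and v = ?v and D = "Suc (arr s ''dist'' ?v)" and d = "arr s ''dist''"],
            goal_cases)
          case (10 t' s'' new)
          have news: "distinct new" "set new = E `` {?v} - set Qs" "set new \<subseteq> {..<n}"
            using 10(1) list_distinct[OF v] list_subset[OF v] unfolding Ev by auto
          have eqs': "reg s'' ''h'' = Suc ?h" "inp s''" "cands C s''"
            "reg s'' ''k'' = reg s ''k'' - reg s' ''j''"
            "\<forall>u<n. arr s'' ''acc'' u = of_bool (u \<in> insert ?v D)"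
            using 10(4) inp' cands' acc by (simp_all add: frame_def eqs inp_def cands_def)
          have setnew: "C - set (Qs @ new) = C - set Qs - ?S \<inter> (C - set Qs)"
            using news(2) unfolding Ev by auto
          have "reg s'' ''k'' = k0 + card (C - set (Qs @ new))"
            unfolding setnew card_dec eqs'(4) k j
            using fin card_mono[of "C - set Qs" "?S \<inter> (C - set Qs)"] by simp
          moreover have "search_inv r C k0 (Qs @ new) (Suc ?h) (insert ?v D) (arr s'' ''dist'')"
          proof (rule search_inv_accept[OF inv hlen news])
            assume "k0 = 0"
            then have "card (C - set Qs - set new) \<noteq> 0"
              using \<open>reg s' ''j'' < reg s' ''k''\<close> card_dec
              unfolding news(2) Ev dec by (simp add: j eqs k)
            then show "C - set Qs - set new \<noteq> {}" by (metis card.empty)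
          qed (rule 10(3))
          ultimately have "search_state r C k0 (Qs @ new) (insert ?v D) s''"
            unfolding search_state_def using eqs' 10(2) by simp
          moreover have "search_potential s'' + (length (L ! ?v) * 62 + 60) = search_potential s"
            using pot 10(2) eqs'(1) .
          ultimately show ?case using t 10(5) by auto
        qed (use inp' cands' Q' v dv Qs in \<open>auto simp: inp_def is_queue_def eqs\<close>)
      next
        case 6
        then show ?case using rejected by blast
      next
        case 7
        then show ?case using rejected t by linarith
      qed
    qed (use inp cands Q v in \<open>auto simp: inp_def is_queue_def cands_def\<close>)
  qed
qed


text \<open>The potential contributes \<open>62 * A + 60 * n\<close>, and clearing
  \<open>seen\<close> and \<open>acc\<close> another \<open>14 * n\<close>.\<close>

lemma wpt_search:
  assumes s: "inp s" "cands C s" "reg s ''r'' = r" "r < n" "reg s ''k'' = k0 + card C" "k0 + card C \<le> B"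
    and post: "\<And>t s' Qs D. search_state r C k0 Qs D s' \<Longrightarrow> reg s' ''h'' = length Qs \<Longrightarrow>
      frame search s s' \<Longrightarrow> t \<le> 62 * A + 74 * n + 35 \<Longrightarrow> Q t s'"
  shows "wpt B search Q s"
proof -
  let ?I = "\<lambda>s. \<exists>Qs D. search_state r C k0 Qs D s"
  let ?G = "\<lambda>t s'. (\<exists>Qs D. search_state r C k0 Qs D s' \<and> reg s' ''h'' = length Qs) \<and>
      t \<le> 62 * A + 74 * n + 35"
  have fin: "finite C" using s(2) finite_subset unfolding cands_def by blast
  have pot: "search_potential s' \<le> 62 * A + 60 * n" for s'
  proof -
    have "search_potential s' \<le> (\<Sum>v<n. length (L ! v) * 62 + 60)"
      unfolding search_potential_def by (rule sum_mono2) auto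
    also have "\<dots> = 62 * A + 60 * n"
      by (simp add: A_eq sum.distrib sum_distrib_left mult.commute)
    finally show ?thesis .
  qed
  have "wpt B search ?G s"
    unfolding search_def
  proof (simp, rule wpt_For[where I = "\<lambda>j s'. \<forall>u<j. arr s' ''seen'' u = 0 \<and> arr s' ''acc'' u = 0"
        and lo = 0 and hi = n and tb = "\<lambda>_. 6"], goal_cases)
    case (6 j s')
    then show ?case using B_bounds by (simp add: less_Suc_eq)
  next
    case (7 j s')
    then show ?case using s inp_n by (simp add: frame_def)
  next
    case (9 t1 s1)
    note zero = 9(1) and f = 9(3) and t1 = 9(4)
    have eqs: "reg s1 ''r'' = r" "reg s1 ''k'' = k0 + card C" "arr s1 ''c'' = arr s ''c''"
      using f s by (simp_all add: frame_def)
    have inp: "inp s1" using f s(1) by (simp add: frame_def inp_def)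
    define x :: nat where "x = of_bool (r \<in> C)"
    have c: "arr s ''c'' r = x" using s by (simp add: cands_def x_def)
    \<comment> \<open>The root may be a candidate, and it counts as reached from the start.\<close>
    have card: "k0 + card C - x = k0 + card (C - {r})"
    proof (cases "r \<in> C")
      case True
      then have "0 < card C" using fin card_gt_0_iff by blast
      then show ?thesis using True fin by (simp add: x_def)
    qed (simp add: x_def)
    let ?s2 = "s1\<lparr>arr := (arr s1)(''seen'' := (arr s1 ''seen'')(r := Suc 0),
          ''dist'' := (arr s1 ''dist'')(r := 0), ''q'' := (arr s1 ''q'')(0 := r)),
        reg := (reg s1)(''h'' := 0, ''t'' := Suc 0, ''k'' := k0 + card (C - {r}))\<rparr>"
    show ?case
    proof (simp add: eqs c card, intro conjI, goal_cases)
      case 6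
      show ?case
      proof (rule wpt_While[where I = ?I and \<Phi> = search_potential], goal_cases)
        case 1
        have "search_state r C k0 [r] {} ?s2"
          unfolding search_state_def
          using inp s(2) zero search_inv_init[OF s(4), of "arr ?s2 ''dist''" C k0]
          by (simp add: inp_def cands_def is_queue_def eqs)
        then show ?case by blast
      next
        case (2 s2)
        then obtain Qs D where "search_state r C k0 Qs D s2" by blast
        from wpt_visit[OF this] show ?case using 2 s(6) by (simp add: numeral_eq_Suc)
      next
        case (3 t2 s2)
        then obtain Qs D where ss: "search_state r C k0 Qs D s2" by blast
        then have "reg s2 ''h'' \<le> length Qs" "reg s2 ''t'' = length Qs"
          by (auto simp: search_state_def is_queue_def dest: search_invD(5))
        moreover have "\<not> reg s2 ''h'' < reg s2 ''t''" using 3(2) by simp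
        ultimately have "reg s2 ''h'' = length Qs" by simp
        have "t2 \<le> 62 * A + 60 * n + 4" using 3(3) pot[of ?s2] by simp
        with \<open>reg s2 ''h'' = length Qs\<close> show ?case using ss t1 by auto
      qed
    qed (use s(4,6) B_bounds card_Diff1_le[of C r] in auto)
  qed (use s inp_n B_bounds in auto)
  then show ?thesis by (rule wpt_frame) (use post in blast)
qed

lemma search_state_result:
  assumes "search_state r C 0 Qs D s" "reg s ''h'' = length Qs"
  shows "search_result E r C D (set Qs)"
proof -
  have inv: "search_inv r C 0 Qs (length Qs) D (arr s ''dist'')"
    using assms by (simp add: search_state_def)
  show ?thesis
    using search_invD(6-10)[OF inv] unfolding search_result_def by simp
qed

lemma search_state_reached:
  assumes "search_state r C k0 Qs D s" "u < n"
  shows "arr s ''seen'' u = of_bool (u \<in> set Qs)" "arr s ''acc'' u = of_bool (u \<in> D)"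
  using assms by (simp_all add: search_state_def is_queue_def)

text \<open>A positive \<open>k0\<close> excludes rejections, so all vertices are reached and
  expanded. Then \<open>dist\<close> grows by at most 1 along every arc, which bounds it from above,
  and by exactly 1 from some predecessor, which bounds it from below.\<close>

lemma search_state_bfs:
  assumes ss: "search_state r C k0 Qs D s" "reg s ''h'' = length Qs" and k0: "k0 > 0"
    and conn: "connected_rel {..<n} E" and v: "v < n"
  shows "arr s ''dist'' v = rdist E r v" "rdist E r v \<le> n"
proof -
  interpret connected_rel "{..<n}" E by (fact conn)
  let ?d = "arr s ''dist''"
  have inv: "search_inv r C k0 Qs (length Qs) D ?d"
    using ss by (simp add: search_state_def)
  note i = search_invD[OF inv]
  have D: "D = set Qs" using i(6,10) k0 by auto
  have r: "r \<in> set Qs" "r \<in> {..<n}" using i(2,7) by blast+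
  have all: "w \<in> set Qs" if "w < n" for w
  proof -
    have "(r, w) \<in> E\<^sup>*" using E_conn that r by simp
    then show ?thesis
      by induction (use i(7) D r in blast)+
  qed
  have "(r, w) \<in> E ^^ k \<Longrightarrow> ?d w \<le> k" for k w
  proof (induction k arbitrary: w)
    case 0
    then show ?case using i(11) by simp
  next
    case (Suc k)
    then obtain y where y: "(r, y) \<in> E ^^ k" "(y, w) \<in> E" by auto
    then have "y \<in> D" using all D E_V by blast
    then have "?d w \<le> Suc (?d y)" using i(13) y by blast
    then show ?case using Suc.IH[OF y(1)] by simp
  qed
  then have "?d v \<le> rdist E r v" using rdist_walk r v by simp
  moreover have "rdist E r w \<le> ?d w" if "w < n" for w
    using that
  proof (induction "?d w" arbitrary: w rule: less_induct)
    case less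
    show ?case
    proof (cases "w = r")
      case False
      then obtain u where u: "u \<in> D" "(u, w) \<in> E" "?d w = Suc (?d u)"
        using i(12) all less.prems by blast
      then have un: "u < n" using E_V by blast
      have "rdist E r w \<le> rdist E r u + rdist E u w"
        using rdist_triangle r(2) un less.prems by simp
      then show ?thesis using less.hyps[of u] u un rdist_edge[OF u(2)] by simp
    qed simp
  qed
  ultimately show "?d v = rdist E r v" using v by (simp add: order_antisym)
  moreover obtain j where "j < length Qs" "Qs ! j = v" using all[OF v] by (metis in_set_conv_nth)
  moreover have "length Qs \<le> n" using i(1,2) card_le_n[of "set Qs"] distinct_card[of Qs] by simp
  ultimately show "rdist E r v \<le> n" using i(14) by fastforce
qed

end

section \<open>The eccentricity program\<close>

text \<open>\<open>T\<close> becomes the least number whose square \<open>S\<close> is at least the number of arcs.\<close>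

definition sqrt_loop :: com where
  "sqrt_loop =
     Seq (Assign ''T'' (N 0))
     (Seq (Assign ''S'' (N 0))
          (While (Less (V ''S'') (Arr ''off'' (V ''n'')))
             (Seq (Assign ''S'' (Plus (V ''S'') (Plus (Plus (V ''T'') (V ''T'')) (N 1))))
                  (Assign ''T'' (Plus (V ''T'') (N 1))))))"

definition init_loop :: com where
  "init_loop =
     Seq (Assign ''i'' (N 0))
         (For ''i'' (V ''n'')
            (Cond (Less (V ''T'') (Minus (Arr ''off'' (Plus (V ''i'') (N 1))) (Arr ''off'' (V ''i''))))
               (Store ''R'' (V ''i'') (N 1))
               (Seq (Store ''c'' (V ''i'') (N 1))
               (Seq (Assign ''k'' (Plus (V ''k'') (N 1)))
                    (Assign ''r'' (V ''i''))))))"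

definition mark :: com where
  "mark = Seq (Store ''R'' (V ''r'') (N 1)) (AdjLoop ''r'' (Store ''R'' (V ''u'') (N 1)))"

text \<open>The root of the next search is an unreached candidate. It is chosen before
  \<open>c\<close> is cleared, since such a vertex is not accepted and loses its flag. The
  candidates left are those in the accepted set, as the next excluded vertex has to come from
  there.\<close>

definition pick :: com where
  "pick =
     Seq (Assign ''k'' (N 0))
     (Seq (Assign ''i'' (N 0))
          (For ''i'' (V ''n'')
             (Seq (Cond (Conj (Eq (Arr ''c'' (V ''i'')) (N 1)) (Eq (Arr ''seen'' (V ''i'')) (N 0)))
                     (Assign ''r'' (V ''i'')) SKIP)
             (Seq (Cond (Eq (Arr ''acc'' (V ''i'')) (N 0)) (Store ''c'' (V ''i'') (N 0)) SKIP)
                  (Assign ''k'' (Plus (V ''k'') (Arr ''c'' (V ''i''))))))))"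

definition phase :: com where
  "phase = Seq mark (Seq search pick)"

text \<open>Distances are symmetric, so one search yields the whole row of \<open>r\<close> and one
  entry in the row of every other vertex.\<close>

definition update :: com where
  "update =
     Seq (Assign ''i'' (N 0))
         (For ''i'' (V ''n'')
            (Seq (Cond (Less (Arr ''ecc'' (V ''i'')) (Arr ''dist'' (V ''i'')))
                    (Store ''ecc'' (V ''i'') (Arr ''dist'' (V ''i''))) SKIP)
                 (Cond (Less (Arr ''ecc'' (V ''r'')) (Arr ''dist'' (V ''i'')))
                    (Store ''ecc'' (V ''r'') (Arr ''dist'' (V ''i''))) SKIP)))"

text \<open>For \<open>k = n + 1\<close> the search never rejects a vertex, whatever candidates are left in \<open>c\<close>.\<close>

definition main_loop :: com where
  "main_loop =
     Seq (Assign ''w'' (N 0))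
         (For ''w'' (V ''n'')
            (Cond (Eq (Arr ''R'' (V ''w'')) (N 1))
               (Seq (Assign ''r'' (V ''w''))
               (Seq (Assign ''k'' (Plus (V ''n'') (N 1)))
               (Seq search update)))
               SKIP))"

definition ecc_prog :: com where
  "ecc_prog = Seq sqrt_loop (Seq init_loop (Seq phase (Seq phase (Seq mark main_loop))))"

lemma wregs_mark [simp]: "wregs mark = {''e'', ''u''}" "warrs mark = {''R''}"
  by (auto simp: mark_def)

lemma wregs_pick [simp]: "wregs pick = {''k'', ''i'', ''r''}" "warrs pick = {''c''}"
  by (auto simp: pick_def)

lemma wregs_update [simp]: "wregs update = {''i''}" "warrs update = {''ecc''}"
  by (auto simp: update_def)

context graph_input
begin

section \<open>Degree threshold, marking of sources and choice of the roots\<close>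

definition tau :: nat where
  "tau = (LEAST t. A \<le> t * t)"

lemma A_le_tau: "A \<le> tau * tau"
  unfolding tau_def using A_le by (rule LeastI)

lemma tau_le: "tau \<le> n"
  unfolding tau_def using A_le by (rule Least_le)

lemma less_tau: "t * t < A \<longleftrightarrow> t < tau"
proof
  assume "t * t < A"
  then have "t * t < tau * tau" using A_le_tau by linarith
  then show "t < tau" using mult_le_mono[of tau t tau t] by linarith
next
  assume "t < tau"
  then show "t * t < A" unfolding tau_def using not_less_Least by (metis not_le)
qed

definition Low :: "nat set" where
  "Low = {v. v < n \<and> length (L ! v) \<le> tau}"

definition marked :: "nat set \<Rightarrow> state \<Rightarrow> bool" where
  "marked R s \<longleftrightarrow> R \<subseteq> {..<n} \<and> (\<forall>u<n. arr s ''R'' u = of_bool (u \<in> R))"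

lemma wpt_sqrt_loop:
  assumes s: "inp s"
    and post: "\<And>t s'. reg s' ''T'' = tau \<Longrightarrow> frame sqrt_loop s s' \<Longrightarrow> t \<le> 20 * tau + 9 \<Longrightarrow> Q t s'"
  shows "wpt B sqrt_loop Q s"
proof -
  let ?I = "\<lambda>s'. inp s' \<and> reg s' ''T'' \<le> tau \<and> reg s' ''S'' = reg s' ''T'' * reg s' ''T''"
  have "wpt B sqrt_loop (\<lambda>t s'. reg s' ''T'' = tau \<and> t \<le> 20 * tau + 9) s"
    unfolding sqrt_loop_def
  proof (simp, rule wpt_While[where I = ?I and \<Phi> = "\<lambda>s'. 20 * (tau - reg s' ''T'')"], goal_cases)
    case 1
    then show ?case using s by (simp add: inp_def)
  next
    case (2 s')
    let ?T = "reg s' ''T''"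
    have lt: "?T < tau" using 2 less_tau by (simp add: inp_off_n inp_n)
    then have "?T \<le> n" using tau_le by simp
    then have "?T * ?T + (?T + ?T + 1) \<le> (n + 2) * (n + 2)"
      using mult_le_mono[of ?T n ?T n] by (simp add: algebra_simps)
    then have "?T * ?T + (?T + ?T + 1) \<le> B" "?T + 1 \<le> B"
      using B_bounds \<open>?T \<le> n\<close> by linarith+
    then show ?case using 2 lt by (simp add: inp_def algebra_simps)
  next
    case (3 t s')
    then have "\<not> reg s' ''T'' < tau" using less_tau by (simp add: inp_off_n inp_n)
    then show ?case using 3 by simp
  qed
  then show ?thesis by (rule wpt_frame) (use post in blast)
qed

lemma wpt_init_loop:
  assumes s: "inp s" "reg s ''T'' = tau" "reg s ''k'' = 0"
      "\<And>u. arr s ''R'' u = 0" "\<And>u. arr s ''c'' u = 0"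
    and post: "\<And>t s'. cands Low s' \<Longrightarrow> marked ({..<n} - Low) s' \<Longrightarrow> reg s' ''k'' = card Low \<Longrightarrow>
      (Low \<noteq> {} \<Longrightarrow> reg s' ''r'' \<in> Low) \<Longrightarrow> frame init_loop s s' \<Longrightarrow> t \<le> 40 * n + 10 \<Longrightarrow> Q t s'"
  shows "wpt B init_loop Q s"
proof -
  let ?I = "\<lambda>j s'. (\<forall>u<n. arr s' ''c'' u = of_bool (u \<in> Low \<and> u < j)) \<and>
      (\<forall>u<n. arr s' ''R'' u = of_bool (u \<notin> Low \<and> u < j)) \<and>
      reg s' ''k'' = card (Low \<inter> {..<j}) \<and> (Low \<inter> {..<j} \<noteq> {} \<longrightarrow> reg s' ''r'' \<in> Low)"
  have sub: "Low \<subseteq> {..<n}" by (auto simp: Low_def)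
  have "wpt B init_loop (\<lambda>t s'. ?I n s' \<and> t \<le> 40 * n + 10) s"
    unfolding init_loop_def
  proof (simp, rule wpt_For[where I = ?I and lo = 0 and hi = n and tb = "\<lambda>_. 30"], goal_cases)
    case (6 j s')
    have inp: "inp s'" and T: "reg s' ''T'' = tau"
      using 6(5) s by (simp_all add: frame_def inp_def)
    have deg: "arr s' ''off'' (Suc j) - arr s' ''off'' j = length (L ! j)"
      using inp_off_Suc[OF inp, of j] 6(2) by simp
    have low: "j \<in> Low \<longleftrightarrow> \<not> tau < length (L ! j)" using 6(2) by (auto simp: Low_def)
    have ins: "Low \<inter> {..<Suc j} = (if j \<in> Low then insert j (Low \<inter> {..<j}) else Low \<inter> {..<j})"
      by (auto simp: less_Suc_eq)
    have "card (Low \<inter> {..<j}) \<le> n" using sub by (intro card_le_n) auto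
    then have le: "Suc (card (Low \<inter> {..<j})) \<le> B" "Suc 0 \<le> B" "j \<le> B" using B_bounds 6(2) by simp_all
    show ?case
    proof (cases "j \<in> Low")
      case True
      then show ?thesis
        using 6(3,4) le low T unfolding ins by (auto simp: deg less_Suc_eq)
    next
      case False
      then show ?thesis
        using 6(3,4) le low T unfolding ins by (auto simp: deg less_Suc_eq)
    qed
  next
    case (7 j s')
    then show ?case using s inp_n by (simp add: frame_def)
  qed (use s inp_n B_bounds in auto)
  then show ?thesis
  proof (rule wpt_frame, goal_cases)
    case (1 t s')
    have "Low \<inter> {..<n} = Low" using sub by blast
    then show ?case
      using 1 sub by (intro post) (auto simp: cands_def marked_def)
  qed
qed

lemma wpt_mark:
  assumes s: "inp s" "reg s ''r'' = r" "r < n" "marked R s"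
    and post: "\<And>t s'. marked (R \<union> cnb E r) s' \<Longrightarrow> frame mark s s' \<Longrightarrow> t \<le> 17 * n + 13 \<Longrightarrow> Q t s'"
  shows "wpt B mark Q s"
proof -
  let ?I = "\<lambda>k s'. marked (insert r R \<union> set (take k (L ! r))) s'"
  have N: "insert r R \<union> set (L ! r) = R \<union> cnb E r"
    using s(3) by (auto simp: cnb_def E_def)
  have "wpt B mark (\<lambda>t s'. marked (R \<union> cnb E r) s' \<and> t \<le> 17 * n + 13) s"
    unfolding mark_def
  proof (simp add: s(2), intro conjI, goal_cases)
    case 3
    show ?case
    proof (rule wpt_AdjLoop[where I = ?I and tb = 3 and v = r], goal_cases)
      case (12 k s')
      have "L ! r ! k < n" using list_lt[OF s(3) 12(1)] .
      moreover have "set (take (Suc k) (L ! r)) = insert (L ! r ! k) (set (take k (L ! r)))"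
        using 12(1) by (simp add: take_Suc_conv_app_nth)
      ultimately show ?case using 12 B_bounds by (simp add: marked_def)
    next
      case (13 t s')
      moreover have "length (L ! r) * 17 \<le> 17 * n" using length_list_le[OF s(3)] by simp
      ultimately show ?case using N by simp
    qed (use s in \<open>auto simp: inp_def marked_def\<close>)
  qed (use s B_bounds in auto)
  then show ?thesis by (rule wpt_frame) (use post in blast)
qed

lemma wpt_pick:
  assumes s: "inp s" "cands C s" "reg s ''r'' = r"
    and seen: "\<And>u. u < n \<Longrightarrow> arr s ''seen'' u = of_bool (u \<in> S)"
    and acc: "\<And>u. u < n \<Longrightarrow> arr s ''acc'' u = of_bool (u \<in> D)"
    and post: "\<And>t s' r'. cands (C \<inter> D) s' \<Longrightarrow> reg s' ''k'' = card (C \<inter> D) \<Longrightarrow> reg s' ''r'' = r' \<Longrightarrow>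
      r' \<in> C - S \<or> C - S = {} \<and> r' = r \<Longrightarrow> frame pick s s' \<Longrightarrow> t \<le> 60 * n + 10 \<Longrightarrow> Q t s'"
  shows "wpt B pick Q s"
proof -
  let ?I = "\<lambda>j s'. (\<forall>u<n. arr s' ''c'' u = of_bool (u \<in> C \<and> (u < j \<longrightarrow> u \<in> D))) \<and>
      reg s' ''k'' = card (C \<inter> D \<inter> {..<j}) \<and>
      (reg s' ''r'' \<in> C - S \<or> (C - S) \<inter> {..<j} = {} \<and> reg s' ''r'' = r)"
  have sub: "C \<subseteq> {..<n}" using s by (simp add: cands_def)
  have "wpt B pick (\<lambda>t s'. ?I n s' \<and> t \<le> 60 * n + 10) s"
    unfolding pick_def
  proof (simp, rule wpt_For[where I = ?I and lo = 0 and hi = n and tb = "\<lambda>_. 40"], goal_cases)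
    case (6 j s')
    have j: "j < n" using 6(2) .
    have eqs: "arr s' ''seen'' j = of_bool (j \<in> S)" "arr s' ''acc'' j = of_bool (j \<in> D)"
      using 6(5) seen[OF j] acc[OF j] by (simp_all add: frame_def)
    have cj: "arr s' ''c'' j = of_bool (j \<in> C)" using 6(3) j by simp
    have ins: "C \<inter> D \<inter> {..<Suc j} =
        (if j \<in> C \<inter> D then insert j (C \<inter> D \<inter> {..<j}) else C \<inter> D \<inter> {..<j})"
      "(C - S) \<inter> {..<Suc j} = (if j \<in> C - S then insert j ((C - S) \<inter> {..<j}) else (C - S) \<inter> {..<j})"
      by (auto simp: less_Suc_eq)
    have card: "card (insert j (C \<inter> D \<inter> {..<j})) = Suc (card (C \<inter> D \<inter> {..<j}))" by simp
    have "card (C \<inter> D \<inter> {..<j}) \<le> n" using sub by (intro card_le_n) auto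
    then have le: "Suc (card (C \<inter> D \<inter> {..<j})) \<le> B" "j \<le> B" using B_bounds j by simp_all
    show ?case
      using 6(3) le
      by (cases "j \<in> C"; cases "j \<in> S"; cases "j \<in> D")
        (auto simp: eqs cj 6(4) ins card less_Suc_eq simp del: Int_iff Diff_iff)
  next
    case (7 j s')
    then show ?case using s inp_n by (simp add: frame_def)
  qed (use s inp_n B_bounds in \<open>auto simp: cands_def\<close>)
  then show ?thesis
  proof (rule wpt_frame, goal_cases)
    case (1 t s')
    have "C \<inter> D \<inter> {..<n} = C \<inter> D" "(C - S) \<inter> {..<n} = C - S" using sub by blast+
    then show ?case
      using 1 sub by (intro post[of s' "reg s' ''r''"]) (auto simp: cands_def)
  qed
qed

end

lemma wregs_phase [simp]:
  "wregs phase = {''i'', ''h'', ''t'', ''k'', ''v'', ''j'', ''D'', ''e'', ''u'', ''r''}"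
  "warrs phase = {''R'', ''seen'', ''acc'', ''dist'', ''q'', ''c''}"
  by (auto simp: phase_def)

context graph_input
begin

lemma wpt_phase:
  assumes s: "inp s" "cands C s" "reg s ''r'' = r" "r < n" "reg s ''k'' = card C" "marked R s"
    and post: "\<And>t s' r' D S. search_result E r C D S \<Longrightarrow> cands (C \<inter> D) s' \<Longrightarrow>
      reg s' ''k'' = card (C \<inter> D) \<Longrightarrow> reg s' ''r'' = r' \<Longrightarrow> r' \<in> C - S \<or> C - S = {} \<and> r' = r \<Longrightarrow>
      marked (R \<union> cnb E r) s' \<Longrightarrow> frame phase s s' \<Longrightarrow> t \<le> 62 * A + 151 * n + 58 \<Longrightarrow> Q t s'"
  shows "wpt B phase Q s"
proof -
  let ?G = "\<lambda>t s'. \<exists>r' D S. search_result E r C D S \<and> cands (C \<inter> D) s' \<and>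
      reg s' ''k'' = card (C \<inter> D) \<and> reg s' ''r'' = r' \<and> (r' \<in> C - S \<or> C - S = {} \<and> r' = r) \<and>
      marked (R \<union> cnb E r) s' \<and> t \<le> 62 * A + 151 * n + 58"
  have card: "card C \<le> B" using s(2) card_le_n[of C] B_bounds by (simp add: cands_def)
  have "wpt B phase ?G s"
    unfolding phase_def wpt_Seq
  proof (rule wpt_mark[OF s(1,3,4,6)])
    fix t1 s1
    assume m: "marked (R \<union> cnb E r) s1" and f1: "frame mark s s1" and t1: "t1 \<le> 17 * n + 13"
    have inp1: "inp s1" and c1: "cands C s1" using inp_frame[OF s(1) f1] cands_frame[OF s(2) f1] by simp_all
    have regs: "reg s1 ''r'' = r" "reg s1 ''k'' = 0 + card C" using f1 s by (simp_all add: frame_def)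
    show "wpt B search (\<lambda>t2. wpt B pick (\<lambda>t3. ?G (t1 + (t2 + t3)))) s1"
    proof (rule wpt_search[OF inp1 c1 regs(1) s(4) regs(2)])
      fix t2 s2 Qs D
      assume ss: "search_state r C 0 Qs D s2" "reg s2 ''h'' = length Qs" and f2: "frame search s1 s2"
        and t2: "t2 \<le> 62 * A + 74 * n + 35"
      have inp2: "inp s2" and c2: "cands C s2" and r2: "reg s2 ''r'' = r"
        using inp_frame[OF inp1 f2] cands_frame[OF c1 f2] regs f2 by (simp_all add: frame_def)
      have sr: "search_result E r C D (set Qs)" using search_state_result[OF ss] .
      show "wpt B pick (\<lambda>t3. ?G (t1 + (t2 + t3))) s2"
      proof (rule wpt_pick[OF inp2 c2 r2 search_state_reached[OF ss(1)]])
        fix t3 s3 r'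
        assume p: "cands (C \<inter> D) s3" "reg s3 ''k'' = card (C \<inter> D)" "reg s3 ''r'' = r'"
          "r' \<in> C - set Qs \<or> C - set Qs = {} \<and> r' = r" and f3: "frame pick s2 s3"
          and t3: "t3 \<le> 60 * n + 10"
        have "marked (R \<union> cnb E r) s3" using m f2 f3 by (simp add: marked_def frame_def)
        moreover have "t1 + (t2 + t3) \<le> 62 * A + 151 * n + 58" using t1 t2 t3 by linarith
        ultimately show "?G (t1 + (t2 + t3)) s3" using p sr by blast
      qed
    qed (use card in simp)
  qed
  then show ?thesis by (rule wpt_frame) (use post in blast)
qed

text \<open>Entries can only be too small, and on the processed sources \<open>P\<close> they are
  exact. Elsewhere they dominate the distances to \<open>P\<close>, which
  \<open>centre_cover\<close> turns into exactness once all sources are processed.\<close>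

definition ecc_inv :: "nat set \<Rightarrow> (nat \<Rightarrow> nat) \<Rightarrow> bool" where
  "ecc_inv P f \<longleftrightarrow> (\<forall>w<n. (\<exists>v<n. f w \<le> rdist E w v) \<and> (\<forall>r\<in>P. rdist E w r \<le> f w) \<and>
     (w \<in> P \<longrightarrow> (\<forall>v<n. rdist E w v \<le> f w)))"

lemma wpt_update:
  assumes s: "inp s" "reg s ''r'' = r" "r < n" "ecc_inv P (arr s ''ecc'')"
    and conn: "connected_rel {..<n} E"
    and dist: "\<And>v. v < n \<Longrightarrow> arr s ''dist'' v = rdist E r v" "\<And>v. v < n \<Longrightarrow> rdist E r v \<le> n"
    and post: "\<And>t s'. ecc_inv (insert r P) (arr s' ''ecc'') \<Longrightarrow> frame update s s' \<Longrightarrow>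
      t \<le> 48 * n + 10 \<Longrightarrow> Q t s'"
  shows "wpt B update Q s"
proof -
  interpret connected_rel "{..<n}" E by (fact conn)
  let ?I = "\<lambda>j s'. ecc_inv P (arr s' ''ecc'') \<and> (\<forall>w<n. w < j \<longrightarrow> rdist E w r \<le> arr s' ''ecc'' w) \<and>
      (\<forall>v<n. v < j \<longrightarrow> rdist E r v \<le> arr s' ''ecc'' r)"
  have mono: "ecc_inv P (f(w := rdist E w v))"
    if "ecc_inv P f" "w < n" "v < n" "f w < rdist E w v" for f w v
    unfolding ecc_inv_def
  proof (intro allI impI)
    fix w' assume w': "w' < n"
    let ?f = "f(w := rdist E w v)"
    have *: "(\<exists>v<n. f w' \<le> rdist E w' v) \<and> (\<forall>r\<in>P. rdist E w' r \<le> f w') \<and>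
        (w' \<in> P \<longrightarrow> (\<forall>v<n. rdist E w' v \<le> f w'))"
      using that(1) w' unfolding ecc_inv_def by blast
    show "(\<exists>v<n. ?f w' \<le> rdist E w' v) \<and> (\<forall>r\<in>P. rdist E w' r \<le> ?f w') \<and>
        (w' \<in> P \<longrightarrow> (\<forall>v<n. rdist E w' v \<le> ?f w'))"
    proof (cases "w' = w")
      case True
      have "rdist E w r \<le> rdist E w v" if "r \<in> P" for r
        using * that True \<open>f w < rdist E w v\<close> by fastforce
      moreover have "rdist E w u \<le> rdist E w v" if "w \<in> P" "u < n" for u
        using * that True \<open>f w < rdist E w v\<close> by fastforce
      ultimately show ?thesis using True that(3) by auto
    qed (use * in simp)
  qed
  have "wpt B update (\<lambda>t s'. ?I n s' \<and> t \<le> 48 * n + 10) s"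
    unfolding update_def
  proof (simp, rule wpt_For[where I = ?I and lo = 0 and hi = n and tb = "\<lambda>_. 40"], goal_cases)
    case (6 j s')
    have j: "j < n" using 6(2) .
    have r: "reg s' ''r'' = r" and d: "arr s' ''dist'' j = rdist E r j"
      using 6(5) s(2) dist(1)[OF j] by (simp_all add: frame_def)
    have le: "j \<le> B" "r \<le> B" "rdist E r j \<le> B" using j s(3) dist(2)[OF j] B_bounds by simp_all
    let ?f = "arr s' ''ecc''"
    let ?g = "if ?f j < rdist E r j then ?f(j := rdist E r j) else ?f"
    let ?h = "if ?g r < rdist E r j then ?g(r := rdist E r j) else ?g"
    have g: "ecc_inv P ?g" using mono[of ?f j r] 6(3) j s(3) rdist_commute[of j r] by simp
    then have h: "ecc_inv P ?h" using mono[of ?g r j] j s(3) by simp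
    have "\<forall>w. ?f w \<le> ?h w" by simp
    then have a1: "\<forall>w<n. w < j \<longrightarrow> rdist E w r \<le> ?h w" "\<forall>v<n. v < j \<longrightarrow> rdist E r v \<le> ?h r"
      using 6(3) by (blast intro: order_trans)+
    moreover have "rdist E j r \<le> ?h j" "rdist E r j \<le> ?h r"
      using rdist_commute[of j r] by simp_all
    ultimately have a2: "\<forall>w<n. w < Suc j \<longrightarrow> rdist E w r \<le> ?h w" "\<forall>v<n. v < Suc j \<longrightarrow> rdist E r v \<le> ?h r"
      unfolding less_Suc_eq by blast+
    let ?body = "Seq (Cond (Less (Arr ''ecc'' (V ''i'')) (Arr ''dist'' (V ''i'')))
        (Store ''ecc'' (V ''i'') (Arr ''dist'' (V ''i''))) SKIP)
      (Cond (Less (Arr ''ecc'' (V ''r'')) (Arr ''dist'' (V ''i'')))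
        (Store ''ecc'' (V ''r'') (Arr ''dist'' (V ''i''))) SKIP)"
    have "wpt B ?body (\<lambda>t s''. t \<le> 40 \<and> arr s'' ''ecc'' = ?h) s'"
      using le by (simp add: 6(4) r d)
    then show ?case
      by (rule wpt_mono) (use h a2 in simp)
  next
    case (7 j s')
    then show ?case using s inp_n by (simp add: frame_def)
  qed (use s inp_n B_bounds in auto)
  then show ?thesis
  proof (rule wpt_frame, goal_cases)
    case (1 t s')
    then have "ecc_inv (insert r P) (arr s' ''ecc'')"
      unfolding ecc_inv_def by auto
    with 1 show ?case using post by blast
  qed
qed

lemma wpt_main_loop:
  assumes s: "inp s" "cands C s" "marked R s" "\<And>w. arr s ''ecc'' w = 0"
    and conn: "connected_rel {..<n} E"
    and post: "\<And>t s'. ecc_inv R (arr s' ''ecc'') \<Longrightarrow>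
      t \<le> card R * (62 * A + 122 * n + 60) + 20 * n + 10 \<Longrightarrow> Q t s'"
  shows "wpt B main_loop Q s"
proof -
  let ?I = "\<lambda>j s'. ecc_inv (R \<inter> {..<j}) (arr s' ''ecc'')"
  \<comment> \<open>A search costs at most \<open>62 * A + 74 * n + 35\<close> and an update
    \<open>48 * n + 10\<close>; the remaining 15 cover the test and the assignments.\<close>
  define K where "K = 62 * A + 122 * n + 60"
  let ?tb = "\<lambda>j. 8 + of_bool (j \<in> R) * K"
  have R: "R \<subseteq> {..<n}" using s(3) by (simp add: marked_def)
  have C: "card C \<le> n" using s(2) by (intro card_le_n) (simp add: cands_def)
  show ?thesis
    unfolding main_loop_def
  proof (simp, rule wpt_For[where I = ?I and lo = 0 and hi = n and tb = ?tb], goal_cases)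
    case 1
    show ?case using s(4) by (auto simp: ecc_inv_def)
  next
    case (6 j s')
    have j: "j < n" using 6(2) .
    have inp: "inp s'" and c: "cands C s'" and Rj: "arr s' ''R'' j = of_bool (j \<in> R)"
      using 6(5) s j by (simp_all add: frame_def inp_def cands_def marked_def)
    show ?case
    proof (cases "j \<in> R")
      case False
      then have "R \<inter> {..<Suc j} = R \<inter> {..<j}" by (auto simp: less_Suc_eq)
      then show ?thesis using False 6(3,4) Rj by simp
    next
      case True
      then have ins: "R \<inter> {..<Suc j} = insert j (R \<inter> {..<j})" by (auto simp: less_Suc_eq)
      let ?s = "s'\<lparr>reg := (reg s')(''r'' := j, ''k'' := Suc n)\<rparr>"
      have "wpt B search (\<lambda>t2. wpt B update (\<lambda>t3 s''. t2 + t3 + 15 \<le> K \<and> ?I (Suc j) s'')) ?s"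
      \<comment> \<open>The candidates left over from the second phase are at most \<open>n\<close>,
        so \<open>k = n + 1\<close> decomposes into \<open>card C\<close> and a positive
        \<open>k0\<close>.\<close>
      proof (rule wpt_search[where C = C and r = j and ?k0.0 = "Suc n - card C"], goal_cases)
        case (7 t2 s2 Qs D)
        have inp2: "inp s2" "reg s2 ''r'' = j" "arr s2 ''ecc'' = arr s' ''ecc''"
          using 7(3) inp by (simp_all add: frame_def inp_def)
        have k0: "Suc n - card C > 0" using C by simp
        show ?case
        proof (rule wpt_update[where P = "R \<inter> {..<j}", OF inp2(1,2) j _ conn], goal_cases)
          case 1
          show ?case using 6(3) inp2(3) by simp
        next
          case 2
          then show ?case by (rule search_state_bfs(1)[OF 7(1,2) k0 conn])
        next
          case 3
          then show ?case by (rule search_state_bfs(2)[OF 7(1,2) k0 conn])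
        next
          case (4 t3 s3)
          then show ?case using 7(4) unfolding ins K_def by simp
        qed
      qed (use inp c j C B_bounds in \<open>auto simp: inp_def cands_def\<close>)
      then have "wpt B search (\<lambda>t2. wpt B update (\<lambda>t3 s''. 11 + (t2 + t3) \<le> ?tb j \<and> ?I (Suc j) s'')) ?s"
        by (rule wpt_mono) (erule wpt_mono, use True in simp)
      then show ?thesis
        using True 6(4) Rj j inp_n[OF inp] B_bounds by (simp add: numeral_eq_Suc)
    qed
  next
    case (7 j s')
    then show ?case using s inp_n by (simp add: frame_def)
  next
    case (9 t s')
    have "(\<Sum>j<n. of_bool (j \<in> R) :: nat) = card R"
      using R by (simp add: of_bool_def sum.If_cases Int_absorb1)
    then have "(\<Sum>j=0..<n. ?tb j + acost (V ''n'') + 7) = 16 * n + card R * K"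
      by (simp add: atLeast0LessThan sum.distrib flip: sum_distrib_right)
    moreover have "R \<inter> {..<n} = R" using R by blast
    ultimately show ?case using 9 by (intro post) (simp_all add: K_def)
  qed (use s inp_n B_bounds in auto)
qed


section \<open>Number of sources and total cost\<close>

lemma card_high_le: "card ({..<n} - Low) \<le> tau"
proof (rule ccontr)
  let ?H = "{..<n} - Low"
  have high: "Suc tau \<le> length (L ! v)" if "v \<in> ?H" for v
    using that by (auto simp: Low_def)
  assume "\<not> ?thesis"
  \<comment> \<open>Too many high vertices would need at least \<open>(tau + 1)^2\<close>
    arcs.\<close>
  then have "Suc tau * Suc tau \<le> card ?H * Suc tau" by (intro mult_le_mono1) simp
  also have "\<dots> \<le> (\<Sum>v\<in>?H. length (L ! v))"
    using sum_bounded_below[of ?H "Suc tau" "\<lambda>v. length (L ! v)", OF high] by simp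
  also have "\<dots> \<le> A" unfolding A_eq by (rule sum_mono2) auto
  also have "\<dots> \<le> tau * tau" by (rule A_le_tau)
  finally show False by simp
qed

lemma card_low_nb_le:
  assumes "v \<in> Low"
  shows "card (cnb E v) \<le> Suc tau"
proof -
  have "cnb E v = insert v (set (L ! v))" using assms by (auto simp: cnb_def E_def Low_def)
  then have "card (cnb E v) \<le> Suc (card (set (L ! v)))" by (simp add: card_insert_le_m1 card_insert_if)
  also have "\<dots> \<le> Suc tau" using assms card_length[of "L ! v"] by (simp add: Low_def)
  finally show ?thesis .
qed

text \<open>If all vertices were high, there would be at most \<open>tau\<close> of them, and no
  degree could exceed \<open>tau\<close>.\<close>

lemma Low_nonempty:
  assumes "n > 0"
  shows "Low \<noteq> {}"
proof
  assume "Low = {}"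
  then have "n \<le> tau" using card_high_le by simp
  then have "0 \<in> Low" using length_list_le[OF assms] assms by (simp add: Low_def)
  then show False using \<open>Low = {}\<close> by simp
qed

lemma inp_initial: "inp (initial_state L)"
  by (simp add: inp_def initial_state_def n_def)

lemma ecc_inv_Max:
  assumes "ecc_inv R f" "w < n"
    and cover: "\<And>v. v < n \<Longrightarrow> w \<notin> R \<Longrightarrow> \<exists>r\<in>R. rdist E w v \<le> rdist E w r"
  shows "f w = Max (rdist E w ` {..<n})"
proof -
  obtain v where v: "v < n" "f w \<le> rdist E w v" using assms unfolding ecc_inv_def by blast
  have le: "rdist E w u \<le> f w" if "u < n" for u
    using assms(1,2) cover[OF that] that unfolding ecc_inv_def by (meson order_trans)
  have "f w = rdist E w v" using v le by (simp add: order_antisym)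
  then have "f w \<in> rdist E w ` {..<n}" using v(1) by blast
  then show ?thesis using le by (intro Max_eqI[symmetric]) auto
qed

lemma wpt_ecc_prog:
  assumes conn: "connected_rel {..<n} E" and AT: "triple_free {..<n} E" and n: "n > 0"
  shows "wpt B ecc_prog (\<lambda>t s. (\<forall>w<n. arr s ''ecc'' w = Max (rdist E w ` {..<n})) \<and>
    t \<le> (4 * tau + 8) * (62 * A + 122 * n + 60)) (initial_state L)"
proof -
  interpret connected_rel "{..<n}" E by (fact conn)
  let ?s0 = "initial_state L" and ?H = "{..<n} - Low"
  let ?G = "\<lambda>t s. (\<forall>w<n. arr s ''ecc'' w = Max (rdist E w ` {..<n})) \<and>
    t \<le> (4 * tau + 8) * (62 * A + 122 * n + 60)"
  have zero: "reg ?s0 ''k'' = 0" "arr ?s0 ''R'' u = 0" "arr ?s0 ''c'' u = 0" "arr ?s0 ''ecc'' u = 0" for u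
    by (simp_all add: initial_state_def)
  have sub: "Low \<subseteq> {..<n}" by (auto simp: Low_def)
  show ?thesis
    unfolding ecc_prog_def wpt_Seq
  proof (rule wpt_sqrt_loop[OF inp_initial], goal_cases)
    case (1 t1 s1)
    note f1 = 1(2)
    have inp1: "inp s1" using inp_frame[OF inp_initial f1] by (simp add: sqrt_loop_def)
    have z1: "reg s1 ''k'' = 0" "arr s1 ''R'' u = 0" "arr s1 ''c'' u = 0" "arr s1 ''ecc'' u = 0" for u
      using f1 zero by (simp_all add: frame_def sqrt_loop_def)
    show ?case
    proof (rule wpt_init_loop[OF inp1 1(1) z1(1-3)], goal_cases)
      case (1 t2 s2)
      note f2 = 1(5) and t2 = 1(6) and c2 = 1(1) and m2 = 1(2) and k2 = 1(3)
      define b where "b = reg s2 ''r''"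
      have b: "b \<in> Low" using 1(4) Low_nonempty[OF n] by (simp add: b_def)
      then have bn: "b < n" using sub by blast
      have inp2: "inp s2" using inp_frame[OF inp1 f2] by (simp add: init_loop_def)
      have z2: "arr s2 ''ecc'' u = 0" for u using f2 z1 by (simp add: frame_def init_loop_def)
      show ?case
      proof (rule wpt_phase[OF inp2 c2 b_def[symmetric] bn k2 m2], goal_cases)
        case (1 t3 s3 x D S)
        note sr3 = 1(1) and c3 = 1(2) and k3 = 1(3) and r3 = 1(4) and x = 1(5) and m3 = 1(6)
          and f3 = 1(7) and t3 = 1(8)
        have xL: "x \<in> Low" using x b by blast
        then have xn: "x < n" using sub by blast
        have inp3: "inp s3" using inp_frame[OF inp2 f3] by simp
        have z3: "arr s3 ''ecc'' u = 0" for u using f3 z2 by (simp add: frame_def)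
        show ?case
        proof (rule wpt_phase[OF inp3 c3 r3 xn k3 m3], goal_cases)
          case (1 t4 s4 z D' S')
          note sr4 = 1(1) and c4 = 1(2) and r4 = 1(4) and z = 1(5) and m4 = 1(6)
            and f4 = 1(7) and t4 = 1(8)
          have zL: "z \<in> Low" using z xL by blast
          then have zn: "z < n" using sub by blast
          have inp4: "inp s4" using inp_frame[OF inp3 f4] by simp
          have z4: "arr s4 ''ecc'' u = 0" for u using f4 z3 by (simp add: frame_def)
          show ?case
          proof (rule wpt_mark[OF inp4 r4 zn m4], goal_cases)
            case (1 t5 s5)
            note m5 = 1(1) and f5 = 1(2) and t5 = 1(3)
            let ?R = "?H \<union> cnb E b \<union> cnb E x \<union> cnb E z"
            have inp5: "inp s5" using inp_frame[OF inp4 f5] by simp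
            have c5: "cands (Low \<inter> D \<inter> D') s5" using cands_frame[OF c4 f5] by simp
            have z5: "arr s5 ''ecc'' u = 0" for u using f5 z4 by (simp add: frame_def)
            have "card ?R \<le> card ?H + card (cnb E b) + card (cnb E x) + card (cnb E z)"
              using card_Un_le[of "?H \<union> cnb E b \<union> cnb E x" "cnb E z"]
                card_Un_le[of "?H \<union> cnb E b" "cnb E x"] card_Un_le[of ?H "cnb E b"] by linarith
            \<comment> \<open>At most \<open>tau\<close> high vertices, and \<open>tau + 1\<close>
              vertices in each of three closed neighbourhoods.\<close>
            also have "\<dots> \<le> 4 * tau + 3"
              using card_high_le card_low_nb_le[OF b] card_low_nb_le[OF xL] card_low_nb_le[OF zL]
              by linarith
            finally have R: "card ?R \<le> 4 * tau + 3" .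
            show ?case
            proof (rule wpt_main_loop[OF inp5 c5 m5 z5 conn], goal_cases)
              case (1 t6 s6)
              let ?K = "62 * A + 122 * n + 60"
              have "card ?R * ?K \<le> (4 * tau + 3) * ?K" using R by (rule mult_le_mono1)
              \<comment> \<open>The five surplus units of \<open>?K\<close> pay for the preparation
                and the loop overhead.\<close>
              moreover have "(4 * tau + 8) * ?K = (4 * tau + 3) * ?K + (310 * A + 610 * n + 300)"
                by (simp add: algebra_simps)
              ultimately have "t1 + (t2 + (t3 + (t4 + (t5 + t6)))) \<le> (4 * tau + 8) * ?K"
                using \<open>t1 \<le> _\<close> t2 t3 t4 t5 1(2) tau_le by linarith
              moreover have "arr s6 ''ecc'' w = Max (rdist E w ` {..<n})" if "w < n" for w
              proof (rule ecc_inv_Max[OF 1(1) that])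
                fix v assume "v < n" "w \<notin> ?R"
                then show "\<exists>r\<in>?R. rdist E w v \<le> rdist E w r"
                  using that x z
                  by (intro centre_cover[OF AT sub b sr3 sr4, of z]) auto
              qed
              ultimately show ?case by blast
            qed
          qed
        qed
      qed
    qed
  qed
qed

lemma E_card: "card E = A"
proof -
  have "E = Sigma {..<n} (\<lambda>u. set (L ! u))" by (auto simp: E_def)
  then have "card E = (\<Sum>u<n. card (set (L ! u)))" by simp
  also have "\<dots> = A" unfolding A_eq by (rule sum.cong) (simp_all add: distinct_card list_distinct)
  finally show ?thesis .
qed

text \<open>With two or more vertices connectivity excludes isolated ones; the 1 is for the
  one-vertex graph. This makes a bound in terms of edges alone possible.\<close>

lemma n_le_A:
  assumes conn: "connected_rel {..<n} E"
  shows "n \<le> A + 1"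
proof (cases "n \<le> 1")
  case False
  interpret connected_rel "{..<n}" E by (fact conn)
  have "1 \<le> length (L ! v)" if "v < n" for v
  proof -
    define u where "u = (if v = 0 then 1 else 0 :: nat)"
    have u: "u < n" "u \<noteq> v" using False by (auto simp: u_def)
    then have "(v, u) \<in> E\<^sup>*" using E_conn that by simp
    then obtain y where "(v, y) \<in> E" using u by (metis converse_rtranclE)
    then have "L ! v \<noteq> []" by (auto simp: E_def)
    then show ?thesis by (cases "L ! v") auto
  qed
  then have "(\<Sum>v<n. 1) \<le> A" unfolding A_eq by (intro sum_mono) simp
  then show ?thesis by simp
qed simp

end

section \<open>The running time as a function of the number of edges\<close>

definition time_bound :: "nat \<Rightarrow> nat" where
  "time_bound m = (4 * (nat \<lfloor>sqrt (2 * real m)\<rfloor> + 1) + 8) * (368 * (m + 1))"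

lemma time_bound_bigo: "(\<lambda>m. real (time_bound m)) \<in> O(\<lambda>m. real m powr (3 / 2))"
\<comment> \<open>The constant is \<open>18 * 368 * 2\<close>. The 18 is
  \<open>4 * 3 / 2 + 12\<close>, with \<open>sqrt 2\<close> rounded up to \<open>3 / 2\<close> and 1
  to the root of \<open>m\<close>; the 2 comes from \<open>m + 1 \<le> 2 * m\<close>.\<close>
proof (rule bigoI[where c = 13248])
  show "\<forall>\<^sub>F m in sequentially. norm (real (time_bound m)) \<le> 13248 * norm (real m powr (3 / 2))"
    using eventually_ge_at_top[of "1::nat"]
  proof eventually_elim
    fix m :: nat assume m: "1 \<le> m"
    have s1: "1 \<le> sqrt (real m)" using m by simp
    have "sqrt 2 \<le> 3 / 2" by (rule real_le_lsqrt) (simp_all add: power2_eq_square)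
    then have s2: "sqrt (2 * real m) \<le> 3 / 2 * sqrt (real m)"
      unfolding real_sqrt_mult by (intro mult_right_mono) simp_all
    have le: "4 * (k + 1) + 8 \<le> 18 * s" if "k \<le> q" "1 \<le> s" "q \<le> 3 / 2 * s" for k q s :: real
      using that by (simp add: field_simps)
    have f: "4 * (real (nat \<lfloor>sqrt (2 * real m)\<rfloor>) + 1) + 8 \<le> 18 * sqrt (real m)"
      by (rule le[OF _ s1 s2]) simp
    have "real (time_bound m) = (4 * (real (nat \<lfloor>sqrt (2 * real m)\<rfloor>) + 1) + 8) * (368 * (real m + 1))"
      by (simp add: time_bound_def)
    also have "\<dots> \<le> (18 * sqrt (real m)) * (368 * (2 * real m))"
      using f m by (intro mult_mono) simp_all
    also have "\<dots> = 13248 * (real m * sqrt (real m))" by simp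
    also have "real m * sqrt (real m) = real m powr (3 / 2)"
      using m powr_add[of "real m" 1 "1/2"] by (simp add: powr_half_sqrt)
    finally show "norm (real (time_bound m)) \<le> 13248 * norm (real m powr (3 / 2))" by simp
  qed
qed

lemma (in graph_input) time_le:
  assumes conn: "connected_rel {..<n} E" and m: "A \<le> 2 * m + 1"
  shows "(4 * tau + 8) * (62 * A + 122 * n + 60) \<le> time_bound m"
proof (unfold time_bound_def, rule mult_le_mono)
  \<comment> \<open>By minimality the square of \<open>tau - 1\<close> is strictly below
    \<open>A\<close>, which absorbs the 1 in the bound on \<open>A\<close>.\<close>
  have "(tau - 1) * (tau - 1) \<le> 2 * m"
  proof (cases "tau = 0")
    case False
    then have "(tau - 1) * (tau - 1) < A" using less_tau by simp
    then show ?thesis using m by linarith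
  qed simp
  then have "real (tau - 1) * real (tau - 1) \<le> 2 * real m"
    by (metis of_nat_le_iff of_nat_mult of_nat_numeral)
  then have "real (tau - 1) \<le> sqrt (2 * real m)"
    by (intro real_le_rsqrt) (simp add: power2_eq_square)
  then have "tau - 1 \<le> nat \<lfloor>sqrt (2 * real m)\<rfloor>"
    by (simp add: le_nat_floor)
  then show "4 * tau + 8 \<le> 4 * (nat \<lfloor>sqrt (2 * real m)\<rfloor> + 1) + 8" by simp
  \<comment> \<open>With \<open>A\<close> at most \<open>2 * m + 1\<close> and \<open>n\<close> at
    most \<open>2 * m + 2\<close>, the factor is \<open>2 * (62 + 122)\<close>.\<close>
  show "62 * A + 122 * n + 60 \<le> 368 * (m + 1)" using n_le_A[OF conn] m by simp
qed

theorem theorem2: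
  shows "\<exists>(P :: com) (c :: nat) (T :: nat \<Rightarrow> nat).
    (\<lambda>m. real (T m)) \<in> O(\<lambda>m. real m powr (3 / 2)) \<and>
    (\<forall>(G :: nat pair_pre_digraph) (L :: nat list list).
       pair_graph G \<longrightarrow> Digraph_Component.connected (with_proj G) \<longrightarrow> AT_free G \<longrightarrow>
       adjacency_lists G L \<longrightarrow>
       (\<exists>t s. exec ((card (pverts G) + 2) ^ c) P (initial_state L) t s \<and>
              t \<le> T (num_edges G) \<and>
              (\<forall>w\<in>pverts G. arr s ''ecc'' w = eccentricity G w)))"
proof (rule exI[of _ ecc_prog], rule exI[of _ 3], rule exI[of _ time_bound], intro conjI allI impI)
  show "(\<lambda>m. real (time_bound m)) \<in> O(\<lambda>m. real m powr (3 / 2))"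
    by (rule time_bound_bigo)
next
  fix G :: "nat pair_pre_digraph" and L :: "nat list list"
  assume G: "pair_graph G" and conn: "Digraph_Component.connected (with_proj G)"
    and AT: "AT_free G" and L: "adjacency_lists G L"
  interpret pair_graph G by (fact G)
  have V: "pverts G = {..<length L}" and lists: "\<And>v. v < length L \<Longrightarrow> distinct (L ! v)"
    "\<And>v. v < length L \<Longrightarrow> set (L ! v) = neighbours G v"
    using L by (simp_all add: adjacency_lists_def)
  interpret I: graph_input L "(card (pverts G) + 2) ^ 3"
  proof
    fix v assume v: "v < length L"
    show "set (L ! v) \<subseteq> {..<length L}"
      using lists(2)[OF v] in_arcsD2 V by (auto simp: neighbours_def)
  qed (use lists V in simp_all)
  have V: "pverts G = {..<I.n}" by (simp add: V I.n_def)
  have E: "I.E = parcs G"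
    using lists(2) in_arcsD1 V unfolding I.E_def I.n_def neighbours_def by auto
  have rel: "connected_rel {..<I.n} I.E"
    using connected_rel_if_connected[OF conn] V E by simp
  have n: "I.n > 0"
    using conn V unfolding Digraph_Component.connected_def strongly_connected_def by auto
  have "triple_free {..<I.n} I.E"
    using triple_free_if_AT_free[OF AT] V E by simp
  from I.wpt_ecc_prog[OF rel this n]
  obtain t s where ex: "exec ((card (pverts G) + 2) ^ 3) ecc_prog (initial_state L) t s"
    and ecc: "\<forall>w<I.n. arr s ''ecc'' w = Max (rdist I.E w ` {..<I.n})"
    and t: "t \<le> (4 * I.tau + 8) * (62 * I.A + 122 * I.n + 60)"
    unfolding wpt_def by blast
  \<comment> \<open>Allowing for the remainder of the division by two spares a proof that the number
    of arcs is even.\<close>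
  have "I.A \<le> 2 * num_edges G + 1"
    unfolding I.E_card[symmetric] E num_edges_def by simp
  then have "t \<le> time_bound (num_edges G)"
    using t I.time_le[OF rel] by (meson order_trans)
  moreover have "arr s ''ecc'' w = eccentricity G w" if w: "w \<in> pverts G" for w
  proof -
    have "gdist G w v = rdist I.E w v" if "v \<in> pverts G" for v
      unfolding E using gdist_eq_rdist[OF w that] connected_rel.E_conn[OF rel] w that V E by simp
    then have "gdist G w ` pverts G = rdist I.E w ` {..<I.n}"
      using V by (intro image_cong) simp_all
    then show ?thesis using ecc w V by (simp add: eccentricity_def)
  qed
  ultimately show "\<exists>t s. exec ((card (pverts G) + 2) ^ 3) ecc_prog (initial_state L) t s \<and>
      t \<le> time_bound (num_edges G) \<and> (\<forall>w\<in>pverts G. arr s ''ecc'' w = eccentricity G w)"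
    using ex by blast
qed

end
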